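(* Let $d\ge2$, $\omega:=\frac1{\sqrt d}\sum_{i=1}^de_i\otimes e_i\in\mathbb C^d\otimes\mathbb C^d$, $P_\omega:=\omega\omega^\ast$, and for $0\le F\le1$ let $\rho_F:=\frac{1-F}{d^2-1}(I-P_\omega)+FP_\omega$. Let $\alpha\in[1,d]$, and write $\alpha=k+\theta$ with $k=\lfloor\alpha\rfloor$, $\theta\in[0,1)$. Then $$\rho_F\in\mathsf K_\alpha\iff F\le f_d(\alpha),\qquad\text{where } f_d(\alpha):=\mu_\alpha(P_\omega)=\frac{(k+\theta)^2}{d(k+\theta^2)}.$$ In particular $f_d(k)=k/d$ for integers $k\in\{1,\dots,d\}$.
   Context: Schmidt coefficients $s_1(\psi)\ge\dots\ge s_d(\psi)\ge0$ of $\psi=\sum a_{ij}e_i\otimes e_j$ are the singular values of $[a_{ij}]$. For $\alpha\in[1,d]$ with $k=\lfloor\alpha\rfloor$, $\theta=\alpha-k$, $r=\lceil\alpha\rceil$, a unit vector $\psi$ is $\alpha$-admissible if $s_j(\psi)=0$ for $j\ge r+1$ and, when $\theta>0$, $s_{k+1}(\psi)\le\frac\theta k\sum_{j=1}^ks_j(\psi)$; $\mathcal V_\alpha$ is the set of these. $\mathsf K_\alpha$ is the closure of the convex cone generated by $\{\psi\psi^\ast:\psi\in\mathcal V_\alpha\}$ in $\mathbb M_d\otimes\mathbb M_d$. For Hermitian $W$, $\mu_\alpha(W):=\max\{\langle\psi,W\psi\rangle:\psi\in\mathcal V_\alpha\}$. *)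

theory Defs
  imports "HOL-Analysis.Analysis" "HOL-Computational_Algebra.Polynomial" "HOL-Library.Multiset"
begin

text \<open>Vectors in C^d (x) C^d are represented as complex^('n*'n) with CARD('n) = d;
  psi $ (i,j) is the coefficient a_ij of e_i (x) e_j.  Operators on C^d (x) C^d are
  complex^('n*'n)^('n*'n) (a finite-dimensional euclidean space, so closure and
  convex cones are the standard ones).\<close>

definition coeff_matrix :: "complex^('n::finite \<times> 'n) \<Rightarrow> complex^'n^'n" where
  "coeff_matrix \<psi> = (\<chi> i j. \<psi> $ (i, j))"

definition conj_transpose :: "complex^'n^'m \<Rightarrow> complex^'m^'n" where
  "conj_transpose A = (\<chi> i j. cnj (A $ j $ i))"

definition char_poly_vec :: "complex^'n^'n \<Rightarrow> complex poly" where
  "char_poly_vec M = det (\<chi> i j. (if i = j then [:0, 1:] else 0) - [: M $ i $ j :])"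

text \<open>Singular values of A, in non-increasing order with multiplicity:
  square roots of the eigenvalues of A A^* (which are real and nonnegative).\<close>
definition singular_values_list :: "complex^'n^'n \<Rightarrow> real list" where
  "singular_values_list A =
     rev (map sqrt (sorted_list_of_multiset
        (image_mset Re (proots (char_poly_vec (A ** conj_transpose A))))))"

definition schmidt_coeff :: "complex^('n::finite \<times> 'n) \<Rightarrow> nat \<Rightarrow> real" where
  "schmidt_coeff \<psi> j =
     (if 1 \<le> j \<and> j \<le> CARD('n) then singular_values_list (coeff_matrix \<psi>) ! (j - 1) else 0)"

definition alpha_admissible :: "real \<Rightarrow> complex^('n::finite \<times> 'n) \<Rightarrow> bool" where
  "alpha_admissible \<alpha> \<psi> \<longleftrightarrow>
     (let k = nat \<lfloor>\<alpha>\<rfloor>; \<theta> = \<alpha> - real k; r = nat \<lceil>\<alpha>\<rceil> in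
       norm \<psi> = 1 \<and>
       (\<forall>j. r + 1 \<le> j \<and> j \<le> CARD('n) \<longrightarrow> schmidt_coeff \<psi> j = 0) \<and>
       (\<theta> > 0 \<longrightarrow> schmidt_coeff \<psi> (k + 1) \<le> \<theta> / real k * (\<Sum>j=1..k. schmidt_coeff \<psi> j)))"

definition V_alpha :: "real \<Rightarrow> (complex^('n::finite \<times> 'n)) set" where
  "V_alpha \<alpha> = {\<psi>. alpha_admissible \<alpha> \<psi>}"

definition outer :: "complex^'m \<Rightarrow> complex^'m^'m" where
  "outer \<psi> = (\<chi> p q. \<psi> $ p * cnj (\<psi> $ q))"

definition K_alpha :: "real \<Rightarrow> (complex^('n::finite \<times> 'n)^('n \<times> 'n)) set" where
  "K_alpha \<alpha> = closure (convex_cone hull (outer ` V_alpha \<alpha>))"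

definition quad_form :: "complex^'m^'m \<Rightarrow> complex^'m \<Rightarrow> complex" where
  "quad_form W \<psi> = (\<Sum>p\<in>UNIV. cnj (\<psi> $ p) * (W *v \<psi>) $ p)"

text \<open>mu_alpha(W) = max over V_alpha of <psi, W psi> (real for Hermitian W).\<close>
definition mu_alpha :: "real \<Rightarrow> complex^('n::finite \<times> 'n)^('n \<times> 'n) \<Rightarrow> real" where
  "mu_alpha \<alpha> W = Sup ((\<lambda>\<psi>. Re (quad_form W \<psi>)) ` (V_alpha \<alpha> :: (complex^('n \<times> 'n)) set))"

definition omega_vec :: "complex^('n::finite \<times> 'n)" where
  "omega_vec = (\<chi> p. if fst p = snd p then complex_of_real (1 / sqrt (real CARD('n))) else 0)"

definition P_omega :: "complex^('n::finite \<times> 'n)^('n \<times> 'n)" where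
  "P_omega = outer omega_vec"

definition rho_F :: "real \<Rightarrow> complex^('n::finite \<times> 'n)^('n \<times> 'n)" where
  "rho_F F = ((1 - F) / (real CARD('n) ^ 2 - 1)) *\<^sub>R (mat 1 - P_omega) + F *\<^sub>R P_omega"

end

(* A trace bound and a symmetrisation. In a basis diagonalising A A* the singular values of A are
   the norms of its rows, so |tr A| is at most their sum; together with Cauchy--Schwarz this bounds
   <psi, P_omega psi> = |tr A|^2 / d on the admissible vectors, and a diagonal A attains the bound.
   Since the bound is linear in psi psi*, it passes to the cone and gives one direction.
   Conversely, the states in the cone with fidelity F form a closed convex set that is invariant
   under conjugation by U (x) cnj U. Its element of least norm is unique, hence fixed by all these
   isometries, and the only fixed state of fidelity F is rho_F. This replaces Haar averaging. *)

theory Submission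
  imports Defs "HOL-Combinatorics.Transposition"
begin

subsection \<open>Diagonalisation of Hermitian matrices\<close>

text \<open>Schmidt coefficients are defined by sorting roots of a characteristic polynomial. The
  trace bound needs only sums over all of them, for which the order is irrelevant and any
  diagonalising basis serves; only admissibility refers to positions. The value of f_d comes from a
  problem in two variables: with S = s_1 + ... + s_k and t = s_(k+1), Cauchy-Schwarz gives S^2/k +
  t^2 \<le> 1, and under k t \<le> \<theta> S the sum S + t is largest at k t = \<theta> S. This is
  the profile proportional to (1, ..., 1, \<theta>), with sum k + \<theta> and squared norm k +
  \<theta>^2. The least-norm argument requires a nonempty set: mixing an optimal vector state with a
  product vector orthogonal to omega reaches every F from 0 to f_d. It also requires invariance: U
  (x) cnj U sends a coefficient matrix A to U A U^*, which keeps singular values and fixes omega,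
  while the Euclidean norm on operators is the Frobenius norm, which unitary conjugation
  preserves.\<close>

definition unitary :: "complex^'n^'n \<Rightarrow> bool" where
  "unitary U \<longleftrightarrow> conj_transpose U ** U = mat 1"

lemma conj_transpose_nth [simp]: "conj_transpose A $ i $ j = cnj (A $ j $ i)"
  by (simp add: conj_transpose_def)

lemma matrix_mult_nth: "(A ** B) $ i $ j = (\<Sum>k\<in>UNIV. A $ i $ k * B $ k $ j)"
  by (simp add: matrix_matrix_mult_def)

lemma conj_transpose_mult: "conj_transpose (A ** B) = conj_transpose B ** conj_transpose A"
  by (simp add: vec_eq_iff matrix_mult_nth mult.commute)

lemma conj_transpose_conj_transpose [simp]: "conj_transpose (conj_transpose A) = A"
  by (simp add: vec_eq_iff)

lemma unitary_right: "unitary U \<Longrightarrow> U ** conj_transpose U = mat 1"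
  by (simp add: unitary_def matrix_left_right_inverse)

lemma unitary_mult: "unitary U \<Longrightarrow> unitary V \<Longrightarrow> unitary (U ** V)"
proof -
  assume U: "unitary U" and V: "unitary V"
  have "conj_transpose (U ** V) ** (U ** V) = conj_transpose V ** (conj_transpose U ** U) ** V"
    by (simp add: conj_transpose_mult matrix_mul_assoc)
  then show ?thesis using U V by (simp add: unitary_def)
qed

lemma unitary_mat_1: "unitary (mat 1)"
proof -
  have "conj_transpose (mat 1) = (mat 1 :: complex^'n^'n)"
    by (simp add: vec_eq_iff mat_def)
  then show ?thesis by (simp add: unitary_def)
qed

lemma norm_matrix_sq: "norm (A :: complex^'n^'m) ^ 2 = (\<Sum>i\<in>UNIV. \<Sum>j\<in>UNIV. (cmod (A $ i $ j))\<^sup>2)"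
  by (simp add: norm_vec_def L2_set_def sum_nonneg)

lemma trace_conj_transpose_mult:
  "trace (conj_transpose A ** A) = of_real (norm (A :: complex^'n^'m) ^ 2)"
proof -
  have "trace (conj_transpose A ** A) = (\<Sum>j\<in>UNIV. \<Sum>i\<in>UNIV. of_real ((cmod (A $ i $ j))\<^sup>2))"
    by (simp add: trace_def matrix_mult_nth complex_norm_square mult.commute del: of_real_power)
  then show ?thesis
    by (subst (asm) sum.swap) (simp add: norm_matrix_sq)
qed

lemma trace_mult_conj_transpose:
  "trace (A ** conj_transpose A) = of_real (norm (A :: complex^'n^'m) ^ 2)"
  by (subst trace_mul_sym) (rule trace_conj_transpose_mult)

text \<open>Supplies the maximiser for the diagonalisation. Boundedness holds because the squared
  Frobenius norm of a unitary is the trace of the identity.\<close>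

lemma compact_unitary: "compact {U :: complex^'n^'n. unitary U}"
proof -
  have "bounded {U :: complex^'n^'n. unitary U}"
    unfolding bounded_iff
  proof (intro exI ballI)
    fix U :: "complex^'n^'n" assume "U \<in> {U. unitary U}"
    then have "complex_of_real (norm U ^ 2) = of_nat CARD('n)"
      using trace_conj_transpose_mult[of U] by (simp add: unitary_def trace_def mat_def)
    then have "norm U ^ 2 = real CARD('n)"
      by (metis of_real_eq_iff of_real_of_nat_eq)
    then show "norm U \<le> sqrt (real CARD('n))"
      by (simp add: real_le_rsqrt)
  qed
  moreover have "closed {U :: complex^'n^'n. unitary U}"
    unfolding unitary_def vec_eq_iff matrix_mult_nth conj_transpose_nth
    by (intro closed_Collect_all closed_Collect_eq continuous_intros)
  ultimately show ?thesis by (simp add: compact_eq_bounded_closed)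
qed

text \<open>On the span of \<open>e_p\<close> and \<open>e_q\<close> this is the matrix with rows
  \<open>(x, - cnj y)\<close> and \<open>(y, x)\<close>. The relevant columns are written as sums of
  single-entry terms, so that products reduce to delta sums.\<close>

definition rotation :: "'n \<Rightarrow> 'n \<Rightarrow> real \<Rightarrow> complex \<Rightarrow> complex^'n^'n" where
  "rotation p q x y = (\<chi> i j.
     if j = p then (if i = p then of_real x else 0) + (if i = q then y else 0)
     else if j = q then (if i = p then - cnj y else 0) + (if i = q then of_real x else 0)
     else if i = j then 1 else 0)"

lemma mult_rotation_nth:
  fixes A :: "complex^'n^'m"
  assumes "p \<noteq> q"
  shows "(A ** rotation p q x y) $ i $ p = A$i$p * of_real x + A$i$q * y"
    and "(A ** rotation p q x y) $ i $ q = A$i$q * of_real x - A$i$p * cnj y"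
    and "j \<noteq> p \<Longrightarrow> j \<noteq> q \<Longrightarrow> (A ** rotation p q x y) $ i $ j = A$i$j"
  using assms
  by (simp_all add: matrix_mult_nth rotation_def distrib_left sum.distrib mult_delta_right)

lemma conj_transpose_rotation_mult_nth:
  assumes "p \<noteq> q"
  shows "(conj_transpose (rotation p q x y) ** A) $ p $ i = of_real x * A$p$i + cnj y * A$q$i"
    and "(conj_transpose (rotation p q x y) ** A) $ q $ i = of_real x * A$q$i - y * A$p$i"
    and "j \<noteq> p \<Longrightarrow> j \<noteq> q \<Longrightarrow> (conj_transpose (rotation p q x y) ** A) $ j $ i = A$j$i"
proof -
  have "conj_transpose (rotation p q x y) ** A = conj_transpose (conj_transpose A ** rotation p q x y)"
    by (simp add: conj_transpose_mult)
  then show "(conj_transpose (rotation p q x y) ** A) $ p $ i = of_real x * A$p$i + cnj y * A$q$i"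
    "(conj_transpose (rotation p q x y) ** A) $ q $ i = of_real x * A$q$i - y * A$p$i"
    "j \<noteq> p \<Longrightarrow> j \<noteq> q \<Longrightarrow> (conj_transpose (rotation p q x y) ** A) $ j $ i = A$j$i"
    using assms by (simp_all add: mult_rotation_nth mult.commute)
qed

lemma unitary_rotation:
  assumes "p \<noteq> q" "x\<^sup>2 + (cmod y)\<^sup>2 = 1"
  shows "unitary (rotation p q x y)"
proof -
  have n: "complex_of_real x * of_real x + y * cnj y = 1"
    using assms(2) by (metis complex_norm_square of_real_1 of_real_add of_real_power power2_eq_square)
  have "(conj_transpose (rotation p q x y) ** rotation p q x y) $ i $ j = mat 1 $ i $ j" for i j
  proof -
    consider "j = p" | "j = q" | "j \<noteq> p" "j \<noteq> q" by blast
    note j = this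
    consider "i = p" | "i = q" | "i \<noteq> p" "i \<noteq> q" by blast
    then show ?thesis
    proof cases
      case 1
      show ?thesis unfolding 1 conj_transpose_rotation_mult_nth(1)[OF assms(1)]
        by (rule j) (use assms(1) n in \<open>auto simp: rotation_def mat_def algebra_simps\<close>)
    next
      case 2
      show ?thesis unfolding 2 conj_transpose_rotation_mult_nth(2)[OF assms(1)]
        by (rule j) (use assms(1) n in \<open>auto simp: rotation_def mat_def algebra_simps\<close>)
    next
      case 3
      show ?thesis unfolding conj_transpose_rotation_mult_nth(3)[OF assms(1) 3]
        by (rule j) (use assms(1) 3 n in \<open>auto simp: rotation_def mat_def algebra_simps\<close>)
    qed
  qed
  then show ?thesis by (simp add: unitary_def vec_eq_iff)
qed

text \<open>The functional maximised below sees only diagonal entries, and a rotation touches just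
  two of them. The mixed terms in \<open>x\<close> and \<open>y\<close> are the first-order
  gain.\<close>

lemma conj_rotation_diag:
  fixes N :: "complex^'n^'n" and x :: real and y :: complex
  assumes "p \<noteq> q"
  defines "R \<equiv> rotation p q x y"
  shows "(conj_transpose R ** N ** R) $ p $ p =
      of_real (x\<^sup>2) * N$p$p + y * cnj y * N$q$q + of_real x * (y * N$p$q + cnj y * N$q$p)"
    and "(conj_transpose R ** N ** R) $ q $ q =
      y * cnj y * N$p$p + of_real (x\<^sup>2) * N$q$q - of_real x * (y * N$p$q + cnj y * N$q$p)"
    and "i \<noteq> p \<Longrightarrow> i \<noteq> q \<Longrightarrow> (conj_transpose R ** N ** R) $ i $ i = N$i$i"
proof -
  note r = mult_rotation_nth[OF assms(1)] conj_transpose_rotation_mult_nth[OF assms(1)]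
  show "(conj_transpose R ** N ** R) $ p $ p =
      of_real (x\<^sup>2) * N$p$p + y * cnj y * N$q$q + of_real x * (y * N$p$q + cnj y * N$q$p)"
    unfolding R_def r by (simp add: algebra_simps power2_eq_square)
  show "(conj_transpose R ** N ** R) $ q $ q =
      y * cnj y * N$p$p + of_real (x\<^sup>2) * N$q$q - of_real x * (y * N$p$q + cnj y * N$q$p)"
    unfolding R_def r by (simp add: algebra_simps power2_eq_square)
  show "(conj_transpose R ** N ** R) $ i $ i = N$i$i" if "i \<noteq> p" "i \<noteq> q"
    unfolding R_def using that by (simp add: r)
qed

text \<open>Brockett's argument: a maximiser of \<open>U \<mapsto> \<Sum>i. c i * (U\<^sup>* M U)\<^sub>i\<^sub>i\<close> with distinct weights
  diagonalises \<open>M\<close>, since a small plane rotation increases the sum to first order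
  as long as some off-diagonal entry does not vanish.\<close>

theorem hermitian_diagonalisation:
  fixes M :: "complex^'n^'n"
  assumes herm: "conj_transpose M = M"
  obtains U where "unitary U" "\<And>i j. i \<noteq> j \<Longrightarrow> (conj_transpose U ** M ** U) $ i $ j = 0"
proof -
  obtain c :: "'n \<Rightarrow> nat" where c: "inj c"
    using finite_imp_inj_to_nat_seg[of "UNIV :: 'n set"] by auto
  define g where "g U = (\<Sum>i\<in>UNIV. real (c i) * Re ((conj_transpose U ** M ** U) $ i $ i))" for U
  have "continuous_on {U. unitary U} g"
    unfolding g_def matrix_mult_nth conj_transpose_nth by (intro continuous_intros)
  moreover have "{U :: complex^'n^'n. unitary U} \<noteq> {}"
    using unitary_mat_1 by blast
  ultimately obtain U :: "complex^'n^'n" where U: "unitary U" and max: "\<And>V. unitary V \<Longrightarrow> g V \<le> g U"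
    using continuous_attains_sup[OF compact_unitary] by (metis mem_Collect_eq)
  define N where "N = conj_transpose U ** M ** U"
  have N: "N $ q $ p = cnj (N $ p $ q)" for p q
  proof -
    have "conj_transpose N = N"
      by (simp add: N_def conj_transpose_mult herm matrix_mul_assoc)
    then show ?thesis by (metis conj_transpose_nth)
  qed
  have "N $ p $ q = 0" if pq: "p \<noteq> q" for p q
  proof (rule ccontr)
    assume nz: "N $ p $ q \<noteq> 0"
    define b where "b = N $ p $ q"
    define e where "e = real (c p) - real (c q)"
    have e: "e \<noteq> 0" using c pq by (auto simp: e_def inj_def)
    define A where "A = e * (Re (N$q$q) - Re (N$p$p))"
    define m where "m = cmod b"
    have m: "m > 0" using nz by (simp add: m_def b_def)
    have ineq: "(s * e * m)\<^sup>2 * A + 2 * x * s * e\<^sup>2 * m\<^sup>2 \<le> 0" if sx: "x\<^sup>2 + (s * e * m)\<^sup>2 = 1" for s x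
    proof -
      \<comment> \<open>The factor \<open>cnj b\<close> makes \<open>y * b\<close> real, and the
        factor \<open>e\<close>, the difference of the weights, makes the first-order gain
        \<open>2 * x * s * e^2 * m^2\<close> positive for positive \<open>x\<close> and
        \<open>s\<close>, whichever weight is larger.\<close>
      define y where "y = of_real (s * e) * cnj b"
      define R where "R = rotation p q x y"
      have y2: "(cmod y)\<^sup>2 = (s * e * m)\<^sup>2"
        by (simp add: y_def m_def norm_mult power_mult_distrib)
      have yc: "y * cnj y = of_real ((s * e * m)\<^sup>2)"
        using y2 by (metis complex_norm_square)
      have yb: "y * b + cnj y * cnj b = of_real (2 * s * e * m\<^sup>2)"
        using complex_norm_square[of b] by (simp add: y_def m_def algebra_simps)
      have uR: "unitary R" using pq sx y2 by (simp add: R_def unitary_rotation)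
      have conj: "conj_transpose (U ** R) ** M ** (U ** R) = conj_transpose R ** N ** R"
        by (simp add: N_def conj_transpose_mult matrix_mul_assoc)
      have xs: "x\<^sup>2 = 1 - (s * e * m)\<^sup>2" using sx by simp
      have bq: "N $ q $ p = cnj b" "N $ p $ q = b" using N[of q p] by (simp_all add: b_def)
      have "0 \<ge> g (U ** R) - g U" using max[OF unitary_mult[OF U uR]] by simp
      also have "g (U ** R) - g U = (\<Sum>i\<in>UNIV. real (c i) *
           (Re ((conj_transpose R ** N ** R) $ i $ i) - Re (N $ i $ i)))"
        unfolding g_def conj by (simp add: N_def right_diff_distrib sum_subtractf)
      also have "\<dots> = (\<Sum>i\<in>{p,q}. real (c i) *
           (Re ((conj_transpose R ** N ** R) $ i $ i) - Re (N $ i $ i)))"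
        by (rule sum.mono_neutral_right) (use pq in \<open>auto simp: R_def conj_rotation_diag(3)\<close>)
      also have "\<dots> = real (c p) * (Re (of_real (x\<^sup>2) * N$p$p + y * cnj y * N$q$q + of_real x * (y * b + cnj y * cnj b)) - Re (N $ p $ p))
         + real (c q) * (Re (y * cnj y * N$p$p + of_real (x\<^sup>2) * N$q$q - of_real x * (y * b + cnj y * cnj b)) - Re (N $ q $ q))"
        using pq unfolding R_def by (simp add: conj_rotation_diag(1,2)[OF pq] bq)
      also have "\<dots> = (s * e * m)\<^sup>2 * A + 2 * x * s * e\<^sup>2 * m\<^sup>2"
        unfolding yc yb xs A_def
        by (simp add: algebra_simps power2_eq_square) (simp add: e_def algebra_simps power2_eq_square)
      finally show ?thesis .
    qed
    text \<open>The point \<open>((1 - u\<^sup>2) / (1 + u\<^sup>2), 2 u / (1 + u\<^sup>2))\<close> of the circle, with \<open>u > 0\<close> so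
      small that the first-order term exceeds the term containing \<open>A\<close>.\<close>
    define w where "w = \<bar>e\<bar> * m"
    have w: "w > 0" using e m by (simp add: w_def)
    have w2: "(s * e * m)\<^sup>2 = s\<^sup>2 * w\<^sup>2" "e\<^sup>2 * m\<^sup>2 = w\<^sup>2" for s
      by (simp_all add: w_def power_mult_distrib)
    \<comment> \<open>The bound 1/2 keeps \<open>1 - u^2\<close> at least 3/4; the other bound keeps
      \<open>\<bar>A\<bar> * u\<close> below \<open>w / 2\<close>, with the summand 1 excluding a
      zero denominator.\<close>
    define u where "u = min (1/2) (w / (2 * (\<bar>A\<bar> + 1)))"
    have u0: "0 < u" using w by (simp add: u_def add_nonneg_pos)
    have u1: "u \<le> 1/2" unfolding u_def by (rule min.cobounded1)
    have u2: "u \<le> w / (2 * (\<bar>A\<bar> + 1))" unfolding u_def by (rule min.cobounded2)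
    have "u * (\<bar>A\<bar> + 1) \<le> w / 2"
      using u2 by (simp add: pos_le_divide_eq add_nonneg_pos mult_ac)
    note u = u0 u1 this
    have "(\<bar>A\<bar> * u) < w * (1 - u\<^sup>2)"
    proof -
      have "u\<^sup>2 \<le> 1/4" using u power_mono[of u "1/2" 2] by (simp add: power2_eq_square)
      then have "w * (1 - u\<^sup>2) \<ge> w * (3/4)" using w by simp
      moreover have "\<bar>A\<bar> * u < u * (\<bar>A\<bar> + 1)" using u by (simp add: algebra_simps)
      ultimately show ?thesis using u w by linarith
    qed
    define D where "D = 1 + u\<^sup>2"
    have D: "D > 0" by (simp add: D_def add_pos_nonneg)
    have "((1 - u\<^sup>2) / D)\<^sup>2 + ((2 * u / (D * w)) * e * m)\<^sup>2 = 1"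
      unfolding w2 using D w
      by (simp add: field_simps) (simp add: D_def power2_eq_square algebra_simps)
    from ineq[OF this]
    have "(2 * u / (D * w))\<^sup>2 * w\<^sup>2 * A + 2 * ((1 - u\<^sup>2) / D) * (2 * u / (D * w)) * w\<^sup>2 \<le> 0"
      unfolding w2 by (simp add: mult.assoc w2)
    moreover have "(2 * u / (D * w))\<^sup>2 * w\<^sup>2 * A + 2 * ((1 - u\<^sup>2) / D) * (2 * u / (D * w)) * w\<^sup>2
       = (4 * u / D\<^sup>2) * (u * A + (1 - u\<^sup>2) * w)"
      using D w by (simp add: field_simps power2_eq_square)
    ultimately have "(4 * u / D\<^sup>2) * (u * A + (1 - u\<^sup>2) * w) \<le> 0"
      by simp
    moreover have "4 * u / D\<^sup>2 > 0" using D u by simp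
    ultimately have "u * A + (1 - u\<^sup>2) * w \<le> 0"
      by (meson mult_le_0_iff not_le)
    moreover have "u * A \<ge> - (\<bar>A\<bar> * u)"
      using u by (metis abs_ge_minus_self abs_mult abs_of_pos minus_le_iff mult.commute)
    moreover have "w * (1 - u\<^sup>2) = (1 - u\<^sup>2) * w" by simp
    ultimately show False using \<open>\<bar>A\<bar> * u < w * (1 - u\<^sup>2)\<close> by linarith
  qed
  then show ?thesis using that[OF U] by (simp add: N_def)
qed

subsection \<open>Singular values and the trace\<close>

lemma finite_sum_singleton_mset: "finite A \<Longrightarrow> (\<Sum>i\<in>A. {#f i#}) = image_mset f (mset_set A)"
  by (induction A rule: finite_induct) auto

lemma char_poly_vec_eq_det: "char_poly_vec M = det (mat [:0, 1:] - (\<chi> i j. [:M $ i $ j:]))"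
  unfolding char_poly_vec_def by (rule arg_cong[where f = det]) (simp add: vec_eq_iff mat_def)

lemma sum_pCons_0: "(\<Sum>i\<in>A. [:f i:]) = [:\<Sum>i\<in>A. f i:]"
  by (simp add: poly_eq_iff coeff_sum coeff_pCons split: nat.split)

lemma const_poly_matrix_mult:
  fixes A B :: "complex^'n^'n"
  shows "(\<chi> i j. [:(A ** B) $ i $ j:]) = (\<chi> i j. [:A $ i $ j:]) ** (\<chi> i j. [:B $ i $ j:])"
  by (simp add: vec_eq_iff matrix_mult_nth sum_pCons_0 [symmetric] mult.commute)

lemma mat_mult_commute:
  fixes A :: "'a::comm_semiring_1^'n^'n"
  shows "A ** mat c = mat c ** A"
  by (simp add: vec_eq_iff matrix_mult_nth mat_def mult_delta_left mult_delta_right mult.commute)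

text \<open>The usual similarity argument, carried out over the polynomial ring: embedding entries
  as constants is multiplicative, so the images of \<open>U\<close> and its adjoint remain inverse
  there and commute past the scalar matrix of the indeterminate.\<close>

lemma char_poly_vec_unitary_conj:
  fixes M :: "complex^'n^'n"
  assumes "unitary U"
  shows "char_poly_vec (conj_transpose U ** M ** U) = char_poly_vec M"
proof -
  define L :: "complex^'n^'n \<Rightarrow> complex poly^'n^'n" where "L A = (\<chi> i j. [:A $ i $ j:])" for A
  have L: "L (A ** B) = L A ** L B" for A B
    by (simp add: L_def const_poly_matrix_mult)
  have 1: "L (conj_transpose U) ** L U = mat 1"
    using assms by (simp add: L[symmetric] unitary_def) (simp add: L_def vec_eq_iff mat_def one_pCons)
  have comm: "L (conj_transpose U) ** mat [:0, 1:] ** L U = mat [:0, 1:] ** (L (conj_transpose U) ** L U)"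
    by (metis mat_mult_commute matrix_mul_assoc)
  have "mat [:0, 1:] - L (conj_transpose U ** M ** U) = L (conj_transpose U) ** (mat [:0, 1:] - L M) ** L U"
    using comm by (simp add: 1 L) (simp add: vec_eq_iff matrix_mult_nth algebra_simps sum_subtractf)
  then have "char_poly_vec (conj_transpose U ** M ** U) =
      det (L (conj_transpose U)) * det (mat [:0, 1:] - L M) * det (L U)"
    by (simp add: char_poly_vec_eq_det L_def[symmetric] det_mul)
  also have "\<dots> = det (L (conj_transpose U) ** L U) * det (mat [:0, 1:] - L M)"
    by (simp add: det_mul mult_ac)
  also have "\<dots> = char_poly_vec M"
    unfolding 1 by (simp add: char_poly_vec_eq_det L_def)
  finally show ?thesis .
qed

lemma proots_char_poly_vec_diagonal:
  assumes "\<And>i j. i \<noteq> j \<Longrightarrow> M $ i $ j = 0"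
  shows "proots (char_poly_vec M) = image_mset (\<lambda>i. M $ i $ i) (mset_set UNIV)"
proof -
  have "char_poly_vec M = (\<Prod>i\<in>UNIV. [:- M $ i $ i, 1:])"
    unfolding char_poly_vec_def by (subst det_diagonal) (use assms in auto)
  then show ?thesis
    by (simp add: proots_prod finite_sum_singleton_mset)
qed

text \<open>Passing to multisets removes the sorting from the definition and keeps multiplicities,
  which is all that symmetric sums need.\<close>

lemma mset_singular_values_list:
  assumes "unitary U"
    and "\<And>i j. i \<noteq> j \<Longrightarrow> (conj_transpose U ** (A ** conj_transpose A) ** U) $ i $ j = 0"
  shows "mset (singular_values_list A) =
    image_mset (\<lambda>i. sqrt (Re ((conj_transpose U ** (A ** conj_transpose A) ** U) $ i $ i))) (mset_set UNIV)"
proof -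
  have "proots (char_poly_vec (A ** conj_transpose A)) =
      image_mset (\<lambda>i. (conj_transpose U ** (A ** conj_transpose A) ** U) $ i $ i) (mset_set UNIV)"
    using proots_char_poly_vec_diagonal[OF assms(2)] by (simp add: char_poly_vec_unitary_conj[OF assms(1)])
  then show ?thesis
    by (simp add: singular_values_list_def multiset.map_comp comp_def)
qed

text \<open>The inner factor \<open>U ** conj_transpose U\<close> cancels, so the product of
  \<open>A\<close> with its adjoint is itself conjugated. This makes Schmidt coefficients invariant
  under U (x) cnj U.\<close>

lemma singular_values_list_unitary_conj:
  assumes "unitary U"
  shows "singular_values_list (conj_transpose U ** A ** U) = singular_values_list A"
proof -
  have "(conj_transpose U ** A ** U) ** conj_transpose (conj_transpose U ** A ** U)
      = conj_transpose U ** A ** (U ** conj_transpose U) ** conj_transpose A ** U"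
    by (simp add: conj_transpose_mult matrix_mul_assoc)
  also have "\<dots> = conj_transpose U ** (A ** conj_transpose A) ** U"
    by (simp add: unitary_right[OF assms] matrix_mul_assoc)
  finally show ?thesis
    by (simp add: singular_values_list_def char_poly_vec_unitary_conj[OF assms])
qed

text \<open>In a basis diagonalising \<open>A A\<^sup>*\<close> the singular values are the norms of the rows of \<open>A\<close>,
  which bound the diagonal entries.\<close>

lemma singular_values_trace_bound:
  fixes A :: "complex^'n^'n"
  obtains \<sigma> :: "'n \<Rightarrow> real" where
    "mset (singular_values_list A) = image_mset \<sigma> (mset_set UNIV)" "\<And>i. \<sigma> i \<ge> 0"
    "cmod (trace A) \<le> (\<Sum>i\<in>UNIV. \<sigma> i)" "(\<Sum>i\<in>UNIV. (\<sigma> i)\<^sup>2) = (norm A)\<^sup>2"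
proof -
  have "conj_transpose (A ** conj_transpose A) = A ** conj_transpose A"
    by (simp add: conj_transpose_mult)
  then obtain U where U: "unitary U"
    and diag: "\<And>i j. i \<noteq> j \<Longrightarrow> (conj_transpose U ** (A ** conj_transpose A) ** U) $ i $ j = 0"
    using hermitian_diagonalisation by blast
  define B where "B = conj_transpose U ** A ** U"
  define \<sigma> where "\<sigma> i = sqrt (\<Sum>j\<in>UNIV. (cmod (B $ i $ j))\<^sup>2)" for i
  have "B ** conj_transpose B = conj_transpose U ** A ** (U ** conj_transpose U) ** conj_transpose A ** U"
    by (simp add: B_def conj_transpose_mult matrix_mul_assoc)
  then have BB: "B ** conj_transpose B = conj_transpose U ** (A ** conj_transpose A) ** U"
    by (simp add: unitary_right[OF U] matrix_mul_assoc)
  have tr: "trace (conj_transpose U ** C ** U) = trace C" for C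
  proof -
    have "trace (conj_transpose U ** C ** U) = trace (U ** (conj_transpose U ** C))"
      by (rule trace_mul_sym)
    then show ?thesis by (simp add: matrix_mul_assoc unitary_right[OF U])
  qed
  have nA: "norm B ^ 2 = norm A ^ 2"
    using trace_mult_conj_transpose[of A] trace_mult_conj_transpose[of B] unfolding BB tr
    by (metis of_real_eq_iff)
  have "(B ** conj_transpose B) $ i $ i = of_real (\<Sum>j\<in>UNIV. (cmod (B $ i $ j))\<^sup>2)" for i
    by (simp add: matrix_mult_nth complex_norm_square del: of_real_power)
  then have "sqrt (Re ((conj_transpose U ** (A ** conj_transpose A) ** U) $ i $ i)) = \<sigma> i" for i
    unfolding BB[symmetric] \<sigma>_def by simp
  then have m: "mset (singular_values_list A) = image_mset \<sigma> (mset_set UNIV)"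
    using mset_singular_values_list[OF U diag] by simp
  have pos: "\<sigma> i \<ge> 0" for i by (simp add: \<sigma>_def sum_nonneg)
  have "cmod (trace A) = cmod (trace B)" by (simp add: B_def tr)
  also have "\<dots> \<le> (\<Sum>i\<in>UNIV. cmod (B $ i $ i))"
    unfolding trace_def by (rule norm_sum)
  also have "\<dots> \<le> (\<Sum>i\<in>UNIV. \<sigma> i)"
    unfolding \<sigma>_def by (intro sum_mono real_le_rsqrt member_le_sum) auto
  finally have t: "cmod (trace A) \<le> (\<Sum>i\<in>UNIV. \<sigma> i)" .
  have "(\<Sum>i\<in>UNIV. (\<sigma> i)\<^sup>2) = (norm B)\<^sup>2"
    unfolding norm_matrix_sq by (simp add: \<sigma>_def sum_nonneg)
  then have "(\<Sum>i\<in>UNIV. (\<sigma> i)\<^sup>2) = (norm A)\<^sup>2"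
    by (simp only: nA)
  then show ?thesis using that m pos t by blast
qed

section \<open>Trace bound for admissible vectors\<close>

lemma norm_coeff_matrix: "norm (coeff_matrix \<psi>) = norm \<psi>"
proof -
  have "(norm (coeff_matrix \<psi>))\<^sup>2 = (norm \<psi>)\<^sup>2"
    unfolding norm_matrix_sq
    by (simp add: norm_vec_def L2_set_def sum_nonneg coeff_matrix_def sum.cartesian_product)
  then show ?thesis by simp
qed

lemma schmidt_coeff_trace_bound:
  fixes \<psi> :: "complex^('n::finite \<times> 'n)"
  shows "cmod (trace (coeff_matrix \<psi>)) \<le> (\<Sum>j=1..CARD('n). schmidt_coeff \<psi> j)"
    and "(\<Sum>j=1..CARD('n). (schmidt_coeff \<psi> j)\<^sup>2) = (norm \<psi>)\<^sup>2"
    and "schmidt_coeff \<psi> j \<ge> 0"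
proof -
  let ?L = "singular_values_list (coeff_matrix \<psi>)"
  obtain \<sigma> :: "'n \<Rightarrow> real" where
    m: "mset ?L = image_mset \<sigma> (mset_set UNIV)" and pos: "\<And>i. \<sigma> i \<ge> 0" and
    t: "cmod (trace (coeff_matrix \<psi>)) \<le> (\<Sum>i\<in>UNIV. \<sigma> i)" "(\<Sum>i\<in>UNIV. (\<sigma> i)\<^sup>2) = (norm (coeff_matrix \<psi>))\<^sup>2"
    using singular_values_trace_bound by blast
  have len: "length ?L = CARD('n)"
    using arg_cong[OF m, of size] by simp
  \<comment> \<open>A general \<open>f\<close> covers both the plain sum and the sum of squares.
    Schmidt indices start at 1 and list positions at 0.\<close>
  have sum: "(\<Sum>j=1..CARD('n). f (schmidt_coeff \<psi> j)) = (\<Sum>i\<in>UNIV. f (\<sigma> i))" for f :: "real \<Rightarrow> real"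
  proof -
    have "(\<Sum>j=1..CARD('n). f (schmidt_coeff \<psi> j)) = (\<Sum>j=0..<CARD('n). f (?L ! j))"
      by (rule sum.reindex_bij_witness[of _ Suc "\<lambda>j. j - 1"]) (auto simp: schmidt_coeff_def)
    also have "\<dots> = sum_list (map f ?L)"
      by (simp add: sum_list_sum_nth len)
    also have "\<dots> = sum_mset (image_mset f (mset ?L))"
      by (simp flip: sum_mset_sum_list)
    also have "\<dots> = (\<Sum>i\<in>UNIV. f (\<sigma> i))"
      by (simp add: m multiset.map_comp comp_def sum_unfold_sum_mset)
    finally show ?thesis .
  qed
  show "cmod (trace (coeff_matrix \<psi>)) \<le> (\<Sum>j=1..CARD('n). schmidt_coeff \<psi> j)"
    using t(1) sum[of "\<lambda>x. x"] by simp
  show "(\<Sum>j=1..CARD('n). (schmidt_coeff \<psi> j)\<^sup>2) = (norm \<psi>)\<^sup>2"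
    using t(2) sum[of "\<lambda>x. x\<^sup>2"] by (simp add: norm_coeff_matrix)
  have "x \<ge> 0" if "x \<in> set ?L" for x
    using that pos arg_cong[OF m, of set_mset] by auto
  then show "schmidt_coeff \<psi> j \<ge> 0"
    by (auto simp: schmidt_coeff_def len)
qed

text \<open>After multiplication by \<open>k\<close> the difference of the two sides factors. One
  factor is \<open>\<theta> * S - k * t\<close>, zero exactly in the extremal case; inserting
  \<open>k * t \<le> \<theta> * S\<close> into the other bounds it below by
  \<open>2 * (k + \<theta>) * (1 - \<theta>) * S\<close>.\<close>

lemma overlap_inequality:
  fixes S t \<theta> k :: real
  assumes "1 \<le> k" "0 \<le> \<theta>" "\<theta> \<le> 1" "0 \<le> S" "0 \<le> t" "k * t \<le> \<theta> * S"
  shows "(S + t)\<^sup>2 * (k + \<theta>\<^sup>2) \<le> (k + \<theta>)\<^sup>2 * (S\<^sup>2 / k + t\<^sup>2)"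
proof -
  have "(k + 2 * \<theta> - 1) * (k * t) \<le> (k + 2 * \<theta> - 1) * (\<theta> * S)"
    using assms by (intro mult_left_mono) auto
  moreover have "0 \<le> 2 * (k + \<theta>) * (1 - \<theta>) * S"
    using assms by simp
  ultimately have 2: "0 \<le> (2 * k + \<theta> - k * \<theta>) * S - k * (k + 2 * \<theta> - 1) * t"
    by (simp add: algebra_simps power2_eq_square)
  have "0 \<le> (\<theta> * S - k * t) * ((2 * k + \<theta> - k * \<theta>) * S - k * (k + 2 * \<theta> - 1) * t)"
    using assms 2 by (intro mult_nonneg_nonneg) auto
  also have "\<dots> = (k + \<theta>)\<^sup>2 * (S\<^sup>2 + k * t\<^sup>2) - k * ((S + t)\<^sup>2 * (k + \<theta>\<^sup>2))"
    by (simp add: algebra_simps power2_eq_square)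
  also have "\<dots> = k * ((k + \<theta>)\<^sup>2 * (S\<^sup>2 / k + t\<^sup>2) - (S + t)\<^sup>2 * (k + \<theta>\<^sup>2))"
    using assms by (simp add: field_simps)
  finally show ?thesis using assms by (simp add: zero_le_mult_iff)
qed

lemma admissible_trace_bound:
  fixes \<psi> :: "complex^('n::finite \<times> 'n)"
  assumes adm: "alpha_admissible \<alpha> \<psi>" and "1 \<le> \<alpha>" "\<alpha> \<le> real CARD('n)"
  defines "k \<equiv> real_of_int \<lfloor>\<alpha>\<rfloor>"
  shows "(cmod (trace (coeff_matrix \<psi>)))\<^sup>2 \<le> \<alpha>\<^sup>2 / (k + (\<alpha> - k)\<^sup>2)"
proof -
  define n where "n = nat \<lfloor>\<alpha>\<rfloor>"
  have n1: "1 \<le> n" using assms(2) by (simp add: n_def le_nat_iff le_floor_iff)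
  have kn: "k = real n" using assms(2) by (simp add: k_def n_def)
  define \<theta> where "\<theta> = \<alpha> - k"
  have \<theta>: "0 \<le> \<theta>" "\<theta> < 1" by (simp_all add: \<theta>_def k_def) linarith
  have nd: "n \<le> CARD('n)" using kn \<theta> assms(3) by (simp add: \<theta>_def)
  let ?s = "schmidt_coeff \<psi>"
  \<comment> \<open>For integral \<alpha> there is no fractional coefficient, and
    \<open>n + 1\<close> may exceed the dimension; the value 0 lets both cases share one
    estimate.\<close>
  define t where "t = (if \<theta> > 0 then ?s (n + 1) else 0)"
  define S where "S = (\<Sum>j=1..n. ?s j)"
  \<comment> \<open>The ceiling of \<alpha> is \<open>n\<close> for integral \<alpha> and
    \<open>n + 1\<close> otherwise, hence the two thresholds.\<close>
  have zero: "?s j = 0" if "j \<ge> n + 1" "\<theta> > 0 \<Longrightarrow> j \<ge> n + 2" "j \<le> CARD('n)" for j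
  proof -
    have "nat \<lceil>\<alpha>\<rceil> + 1 \<le> j"
    proof (cases "\<theta> > 0")
      case True
      have "\<lceil>\<alpha>\<rceil> \<le> int n + 1" using \<theta> kn by (simp add: ceiling_le_iff \<theta>_def)
      then show ?thesis using that(2)[OF True] by linarith
    next
      case False
      then have "\<lceil>\<alpha>\<rceil> \<le> int n" using \<theta> kn by (simp add: ceiling_le_iff \<theta>_def)
      then show ?thesis using that(1) by linarith
    qed
    then show ?thesis using adm that(3) by (simp add: alpha_admissible_def Let_def)
  qed
  have split: "(\<Sum>j=1..CARD('n). f (?s j)) = (\<Sum>j=1..n. f (?s j)) + f t" if "f 0 = 0" for f :: "real \<Rightarrow> real"
  proof (cases "\<theta> > 0")
    case True
    then have "n + 1 \<le> CARD('n)" using kn assms(3) by (simp add: \<theta>_def)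
    then have "(\<Sum>j=1..CARD('n). f (?s j)) = (\<Sum>j\<in>insert (n+1) {1..n}. f (?s j))"
      using zero by (intro sum.mono_neutral_right ballI) (auto simp: that)
    then show ?thesis using True by (simp add: t_def)
  next
    case False
    have "(\<Sum>j=1..CARD('n). f (?s j)) = (\<Sum>j\<in>{1..n}. f (?s j))"
      using False nd zero by (intro sum.mono_neutral_right ballI) (auto simp: that)
    then show ?thesis using False by (simp add: t_def that)
  qed
  have S0: "S \<ge> 0" unfolding S_def by (intro sum_nonneg schmidt_coeff_trace_bound(3))
  have t0: "t \<ge> 0" by (simp add: t_def schmidt_coeff_trace_bound(3))
  have kt: "k * t \<le> \<theta> * S"
  proof (cases "\<theta> > 0")
    case True
    then have "t \<le> \<theta> / k * S"
      using adm by (simp add: alpha_admissible_def Let_def t_def S_def n_def[symmetric] \<theta>_def kn)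
    then show ?thesis using n1 kn by (simp add: field_simps)
  qed (use \<theta> S0 in \<open>simp add: t_def\<close>)
  have "S\<^sup>2 / k \<le> (\<Sum>j=1..n. (?s j)\<^sup>2)"
    using sum_squared_le_sum_of_squares[of ?s "{1..n}"] n1 kn
    by (simp add: S_def field_simps)
  moreover have "(\<Sum>j=1..n. (?s j)\<^sup>2) + t\<^sup>2 = 1"
    using schmidt_coeff_trace_bound(2)[of \<psi>] split[of "\<lambda>x. x\<^sup>2"] adm
    by (simp add: alpha_admissible_def Let_def)
  ultimately have 1: "S\<^sup>2 / k + t\<^sup>2 \<le> 1" by simp
  have "(S + t)\<^sup>2 * (k + \<theta>\<^sup>2) \<le> (k + \<theta>)\<^sup>2 * (S\<^sup>2 / k + t\<^sup>2)"
    using n1 kn \<theta> S0 t0 kt by (intro overlap_inequality) auto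
  also have "\<dots> \<le> \<alpha>\<^sup>2"
    using mult_left_mono[OF 1, of "(k + \<theta>)\<^sup>2"] by (simp add: \<theta>_def)
  finally have "(S + t)\<^sup>2 \<le> \<alpha>\<^sup>2 / (k + \<theta>\<^sup>2)"
    using n1 kn by (simp add: pos_le_divide_eq add_pos_nonneg)
  moreover have "cmod (trace (coeff_matrix \<psi>)) \<le> S + t"
    using schmidt_coeff_trace_bound(1)[of \<psi>] split[of "\<lambda>x. x"] by (simp add: S_def)
  then have "(cmod (trace (coeff_matrix \<psi>)))\<^sup>2 \<le> (S + t)\<^sup>2"
    by (simp add: power_mono)
  ultimately show ?thesis by (simp add: \<theta>_def)
qed

subsection \<open>The maximal fidelity of an admissible vector\<close>

text \<open>For injective \<open>\<pi>\<close> the coefficient matrix is a permuted diagonal matrix,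
  so its singular values are the \<open>\<bar>s i\<bar>\<close> while its trace depends on the fixed
  points of \<open>\<pi>\<close>. The identity gives the optimal vector and omega, a transposition
  gives a traceless vector.\<close>

definition monomial_vec :: "('n \<Rightarrow> 'n) \<Rightarrow> ('n \<Rightarrow> real) \<Rightarrow> complex^('n::finite \<times> 'n)" where
  "monomial_vec \<pi> s = (\<chi> p. if snd p = \<pi> (fst p) then of_real (s (fst p)) else 0)"

lemma sum_UNIV_prod: "(\<Sum>p\<in>UNIV. g p) = (\<Sum>i\<in>UNIV. \<Sum>j\<in>UNIV. g (i, j))"
  by (simp add: sum.cartesian_product)

lemma norm_monomial_vec: "(norm (monomial_vec \<pi> s))\<^sup>2 = (\<Sum>i\<in>UNIV. (s i)\<^sup>2)"
proof -
  have "(norm (monomial_vec \<pi> s))\<^sup>2 = (\<Sum>p\<in>UNIV. (cmod (monomial_vec \<pi> s $ p))\<^sup>2)"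
    by (simp add: norm_vec_def L2_set_def sum_nonneg)
  also have "\<dots> = (\<Sum>i\<in>UNIV. \<Sum>j\<in>UNIV. if j = \<pi> i then (s i)\<^sup>2 else 0)"
    unfolding sum_UNIV_prod by (intro sum.cong refl) (simp add: monomial_vec_def)
  finally show ?thesis by simp
qed

lemma trace_monomial_vec:
  "trace (coeff_matrix (monomial_vec \<pi> s)) = (\<Sum>i\<in>UNIV. if \<pi> i = i then of_real (s i) else 0)"
  unfolding trace_def by (intro sum.cong refl) (simp add: coeff_matrix_def monomial_vec_def)

text \<open>Admissibility refers to positions, so here the sorted list itself is computed. The
  product of \<open>A\<close> with its adjoint is diagonal whatever the injection
  \<open>\<pi>\<close> is, and \<open>f\<close> numbers the basis so that the profile
  \<open>\<tau>\<close> is already in decreasing order.\<close>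

lemma schmidt_coeff_monomial_vec:
  fixes f :: "'n::finite \<Rightarrow> nat"
  assumes f: "bij_betw f UNIV {1..CARD('n)}" and \<pi>: "inj \<pi>"
    and mono: "\<And>i j. 1 \<le> i \<Longrightarrow> i \<le> j \<Longrightarrow> j \<le> CARD('n) \<Longrightarrow> \<tau> j \<le> \<tau> i"
    and nonneg: "\<And>i. 0 \<le> \<tau> i"
    and j: "1 \<le> j" "j \<le> CARD('n)"
  shows "schmidt_coeff (monomial_vec \<pi> (\<lambda>i. \<tau> (f i))) j = \<tau> j"
proof -
  define A where "A = coeff_matrix (monomial_vec \<pi> (\<lambda>i. \<tau> (f i)))"
  have A: "A $ i $ l = (if l = \<pi> i then of_real (\<tau> (f i)) else 0)" for i l
    by (simp add: A_def coeff_matrix_def monomial_vec_def)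
  have AA: "(A ** conj_transpose A) $ i $ l = (if i = l then of_real ((\<tau> (f i))\<^sup>2) else 0)" for i l
    using \<pi> by (auto simp: matrix_mult_nth A mult_delta_left inj_eq power2_eq_square)
  \<comment> \<open>The list is reversed because sorting is ascending; the final \<open>rev\<close>
    in the definition of singular values restores the order of \<open>\<tau>\<close>.\<close>
  define xs where "xs = rev (map (\<lambda>i. (\<tau> i)\<^sup>2) [1..<CARD('n) + 1])"
  have "image_mset Re (proots (char_poly_vec (A ** conj_transpose A))) =
      image_mset (\<lambda>i. (\<tau> i)\<^sup>2) (image_mset f (mset_set UNIV))"
    by (subst proots_char_poly_vec_diagonal) (simp_all add: AA multiset.map_comp comp_def)
  also have "image_mset f (mset_set UNIV) = mset_set {1..<CARD('n) + 1}"
    using f by (simp add: bij_betw_def image_mset_mset_set atLeastLessThanSuc_atLeastAtMost)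
  also have "image_mset (\<lambda>i. (\<tau> i)\<^sup>2) \<dots> = mset xs"
    by (simp add: xs_def del: upt_Suc)
  finally have m: "image_mset Re (proots (char_poly_vec (A ** conj_transpose A))) = mset xs" .
  have "sorted xs"
    unfolding xs_def sorted_wrt_rev sorted_wrt_map
    by (rule sorted_wrt_mono_rel[OF _ sorted_upt])
      (auto intro!: power_mono mono nonneg simp del: upt_Suc)
  then have "singular_values_list A = rev (map sqrt xs)"
    by (simp add: singular_values_list_def m sorted_sort_id)
  also have "\<dots> = map \<tau> [1..<CARD('n) + 1]"
    by (simp add: xs_def rev_map nonneg comp_def del: upt_Suc)
  finally show ?thesis
    using j by (simp add: schmidt_coeff_def A_def del: upt_Suc)
qed

section \<open>Fidelity with the maximally entangled vector\<close>

lemma quad_form_outer: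
  "quad_form (outer w) v = of_real ((cmod (\<Sum>q\<in>UNIV. cnj (w $ q) * v $ q))\<^sup>2)"
proof -
  have "quad_form (outer w) v = (\<Sum>p\<in>UNIV. cnj (v $ p) * w $ p) * (\<Sum>q\<in>UNIV. cnj (w $ q) * v $ q)"
    by (simp add: quad_form_def outer_def matrix_vector_mult_def sum_distrib_left sum_distrib_right mult_ac)
  also have "(\<Sum>p\<in>UNIV. cnj (v $ p) * w $ p) = cnj (\<Sum>q\<in>UNIV. cnj (w $ q) * v $ q)"
    by (simp add: mult.commute)
  finally show ?thesis by (simp only: complex_norm_square mult.commute)
qed

text \<open>Exchanging the roles of vector and projector turns the bound on admissible vectors into
  a bound that is linear in the operator.\<close>

lemma quad_form_outer_commute: "quad_form (outer w) v = quad_form (outer v) w"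
proof -
  have "(\<Sum>q\<in>UNIV. cnj (w $ q) * v $ q) = cnj (\<Sum>q\<in>UNIV. cnj (v $ q) * w $ q)"
    by (simp add: mult.commute)
  then show ?thesis unfolding quad_form_outer by (simp only: complex_mod_cnj)
qed

lemma quad_form_P_omega:
  fixes \<psi> :: "complex^('n::finite \<times> 'n)"
  shows "quad_form P_omega \<psi> = of_real ((cmod (trace (coeff_matrix \<psi>)))\<^sup>2 / real CARD('n))"
proof -
  have "(\<Sum>q\<in>UNIV. cnj (omega_vec $ q) * \<psi> $ q) = of_real (1 / sqrt (real CARD('n))) * trace (coeff_matrix \<psi>)"
    unfolding sum_UNIV_prod trace_def sum_distrib_left
    by (intro sum.cong refl) (simp add: omega_vec_def coeff_matrix_def if_distrib if_distribR cong: if_cong)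
  then show ?thesis
    unfolding P_omega_def quad_form_outer
    by (simp add: norm_mult norm_divide power_mult_distrib power_divide)
qed

text \<open>The extremal profile: equality in the Cauchy--Schwarz step and in the constraint on \<open>s\<^sub>k\<^sub>+\<^sub>1\<close>.\<close>

lemma V_alpha_optimal:
  assumes "1 \<le> \<alpha>" "\<alpha> \<le> real CARD('n::finite)"
  defines "k \<equiv> real_of_int \<lfloor>\<alpha>\<rfloor>"
  obtains \<psi> :: "complex^('n::finite \<times> 'n)" where "\<psi> \<in> V_alpha \<alpha>"
    "(cmod (trace (coeff_matrix \<psi>)))\<^sup>2 = \<alpha>\<^sup>2 / (k + (\<alpha> - k)\<^sup>2)"
proof -
  define n where "n = nat \<lfloor>\<alpha>\<rfloor>"
  have n1: "1 \<le> n" using assms(1) by (simp add: n_def le_nat_iff le_floor_iff)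
  have kn: "k = real n" using assms(1) by (simp add: k_def n_def)
  define \<theta> where "\<theta> = \<alpha> - k"
  have \<theta>: "0 \<le> \<theta>" "\<theta> < 1" by (simp_all add: \<theta>_def k_def) linarith
  have nd: "n \<le> CARD('n)" using kn \<theta> assms(2) by (simp add: \<theta>_def)
  have nd': "\<theta> > 0 \<Longrightarrow> n < CARD('n)" using kn assms(2) by (simp add: \<theta>_def)
  define N where "N = sqrt (k + \<theta>\<^sup>2)"
  have N: "N > 0" "N\<^sup>2 = k + \<theta>\<^sup>2" using n1 kn by (simp_all add: N_def add_pos_nonneg)
  define \<tau> where "\<tau> j = (if j \<le> n then 1 else if j = n + 1 then \<theta> else 0) / N" for j
  obtain f :: "'n \<Rightarrow> nat" where f: "bij_betw f UNIV {1..CARD('n)}"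
    using finite_same_card_bij[of "UNIV :: 'n set" "{1..CARD('n)}"] by auto
  define \<psi> where "\<psi> = monomial_vec id (\<lambda>i. \<tau> (f i))"
  have s: "schmidt_coeff \<psi> j = \<tau> j" if "1 \<le> j" "j \<le> CARD('n)" for j
    unfolding \<psi>_def using \<theta> N(1) that
    by (intro schmidt_coeff_monomial_vec[OF f]) (auto simp: \<tau>_def intro!: divide_right_mono)
  have sum: "(\<Sum>i\<in>UNIV. g (\<tau> (f i))) = real n * g (1 / N) + g (\<theta> / N)" if "g 0 = 0" for g :: "real \<Rightarrow> real"
  proof -
    have "(\<Sum>i\<in>UNIV. g (\<tau> (f i))) = (\<Sum>j\<in>{1..CARD('n)}. g (\<tau> j))"
      using sum.reindex_bij_betw[OF f] .
    also have "\<dots> = (\<Sum>j\<in>{1..n}. g (\<tau> j)) + (\<Sum>j\<in>{n+1..CARD('n)}. g (\<tau> j))"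
      using nd by (subst sum.union_disjoint[symmetric]) (auto intro!: sum.cong)
    also have "(\<Sum>j\<in>{n+1..CARD('n)}. g (\<tau> j)) = g (\<theta> / N)"
    proof (cases "\<theta> > 0")
      case True
      have "(\<Sum>j\<in>{n+1..CARD('n)}. g (\<tau> j)) = (\<Sum>j\<in>{n+1}. g (\<tau> j))"
        using nd'[OF True] by (intro sum.mono_neutral_right) (auto simp: \<tau>_def that)
      then show ?thesis by (simp add: \<tau>_def)
    next
      case False
      then have "\<tau> j = 0" if "j > n" for j using \<theta> that by (simp add: \<tau>_def)
      then show ?thesis using False \<theta> that by simp
    qed
    also have "(\<Sum>j\<in>{1..n}. g (\<tau> j)) = real n * g (1 / N)"
      by (simp add: \<tau>_def)
    finally show ?thesis .
  qed
  have "(norm \<psi>)\<^sup>2 = (k + \<theta>\<^sup>2) / N\<^sup>2"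
    unfolding \<psi>_def norm_monomial_vec using sum[of "\<lambda>x. x\<^sup>2"]
    by (simp add: kn power_divide add_divide_distrib)
  then have "(norm \<psi>)\<^sup>2 = 1" using N by (metis divide_self less_irrefl zero_less_power)
  then have norm: "norm \<psi> = 1" using norm_ge_zero[of \<psi>] by (simp add: power2_eq_1_iff)
  have "schmidt_coeff \<psi> j = 0" if "nat \<lceil>\<alpha>\<rceil> + 1 \<le> j" "j \<le> CARD('n)" for j
  proof -
    have "n \<le> nat \<lceil>\<alpha>\<rceil>" by (simp add: n_def nat_mono)
    then have "\<not> j \<le> n" "1 \<le> j" using that(1) by auto
    \<comment> \<open>The index \<open>n + 1\<close> lies beyond the ceiling only for integral
      \<alpha>, and then the entry placed there vanishes anyway.\<close>
    moreover have "\<theta> = 0" if "j = n + 1"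
    proof -
      have "nat \<lceil>\<alpha>\<rceil> \<le> n" using that \<open>nat \<lceil>\<alpha>\<rceil> + 1 \<le> j\<close> by simp
      then have "\<alpha> \<le> real n" by linarith
      then show ?thesis using kn \<theta> by (simp add: \<theta>_def)
    qed
    ultimately show ?thesis using s[of j] that(2) by (auto simp: \<tau>_def)
  qed
  moreover have "schmidt_coeff \<psi> (n + 1) \<le> \<theta> / real n * (\<Sum>j=1..n. schmidt_coeff \<psi> j)" if "\<theta> > 0"
  proof -
    have "(\<Sum>j=1..n. schmidt_coeff \<psi> j) = (\<Sum>j=1..n. 1 / N)"
      using nd by (intro sum.cong refl) (simp add: s, simp add: \<tau>_def)
    then show ?thesis using s[of "n + 1"] nd'[OF that] n1 by (simp add: \<tau>_def)
  qed
  ultimately have "\<psi> \<in> V_alpha \<alpha>"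
    using norm by (simp add: V_alpha_def alpha_admissible_def Let_def n_def[symmetric] \<theta>_def kn)
  moreover have "trace (coeff_matrix \<psi>) = of_real ((k + \<theta>) / N)"
    unfolding \<psi>_def trace_monomial_vec using sum[of "\<lambda>x. x"]
    by (simp add: kn add_divide_distrib flip: of_real_sum)
  then have "(cmod (trace (coeff_matrix \<psi>)))\<^sup>2 = \<alpha>\<^sup>2 / (k + (\<alpha> - k)\<^sup>2)"
    using N by (simp add: \<theta>_def norm_divide power_divide)
  ultimately show ?thesis using that by blast
qed

text \<open>Provides the fidelity-zero end of the mixture. The witness is the product vector of two
  distinct basis vectors: its Schmidt coefficients are 1, 0, ..., 0, which is admissible for every
  \<alpha> \<ge> 1.\<close>

lemma V_alpha_traceless:
  assumes "CARD('n::finite) \<ge> 2" "1 \<le> \<alpha>"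
  obtains \<psi> :: "complex^('n::finite \<times> 'n)" where "\<psi> \<in> V_alpha \<alpha>" "trace (coeff_matrix \<psi>) = 0"
proof -
  obtain f :: "'n \<Rightarrow> nat" where f: "bij_betw f UNIV {1..CARD('n)}"
    using finite_same_card_bij[of "UNIV :: 'n set" "{1..CARD('n)}"] by auto
  then obtain a b where ab: "f a = 1" "f b = 2"
    using assms(1) unfolding bij_betw_def
    by (metis atLeastAtMost_iff imageE le_refl one_le_numeral order_trans)
  define n where "n = nat \<lfloor>\<alpha>\<rfloor>"
  define \<tau> :: "nat \<Rightarrow> real" where "\<tau> j = (if j \<le> 1 then 1 else 0)" for j
  define \<psi> where "\<psi> = monomial_vec (Transposition.transpose a b) (\<lambda>i. \<tau> (f i))"
  have s: "schmidt_coeff \<psi> j = \<tau> j" if "1 \<le> j" "j \<le> CARD('n)" for j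
    unfolding \<psi>_def using that
    by (intro schmidt_coeff_monomial_vec[OF f]) (auto simp: \<tau>_def)
  have f1: "f i \<le> Suc 0 \<longleftrightarrow> i = a" for i
  proof -
    have "f i \<ge> 1" using bij_betw_apply[OF f, of i] by simp
    moreover have "f i = f a \<longleftrightarrow> i = a" using bij_betw_imp_inj_on[OF f] by (simp add: inj_eq)
    ultimately show ?thesis using ab(1) by auto
  qed
  have "(norm \<psi>)\<^sup>2 = 1"
    unfolding \<psi>_def norm_monomial_vec by (simp add: \<tau>_def f1 if_distrib if_distribR cong: if_cong)
  then have "norm \<psi> = 1" using norm_ge_zero[of \<psi>] by (simp add: power2_eq_1_iff)
  moreover have "nat \<lceil>\<alpha>\<rceil> \<ge> 1" "nat \<lfloor>\<alpha>\<rfloor> \<ge> 1" using assms(2) by (simp_all add: le_nat_iff le_floor_iff)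
  moreover have "schmidt_coeff \<psi> j = 0" if "j \<ge> 2" for j
    using s[of j] that by (cases "j \<le> CARD('n)") (simp_all add: \<tau>_def, simp add: schmidt_coeff_def)
  moreover have "0 \<le> (\<alpha> - real m) / real m * (\<Sum>j=1..m. schmidt_coeff \<psi> j)" if "\<alpha> - real m > 0" for m
    using that by (intro mult_nonneg_nonneg sum_nonneg schmidt_coeff_trace_bound(3)) auto
  ultimately have "\<psi> \<in> V_alpha \<alpha>"
    by (simp add: V_alpha_def alpha_admissible_def Let_def flip: n_def)
  moreover have "trace (coeff_matrix \<psi>) = 0"
    unfolding \<psi>_def trace_monomial_vec
    using ab by (intro sum.neutral) (auto simp: \<tau>_def f1 Transposition.transpose_def)
  ultimately show ?thesis using that by blast
qed

text \<open>The supremum is attained by the optimal vector. The second claim is recorded because a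
  supremum of reals is an upper bound only once the set is known to be bounded.\<close>

lemma mu_alpha_P_omega:
  assumes "1 \<le> \<alpha>" "\<alpha> \<le> real CARD('n::finite)"
  defines "k \<equiv> real_of_int \<lfloor>\<alpha>\<rfloor>"
  shows "mu_alpha \<alpha> (P_omega :: complex^('n \<times> 'n)^('n \<times> 'n)) = \<alpha>\<^sup>2 / (real CARD('n) * (k + (\<alpha> - k)\<^sup>2))"
    and "\<And>\<psi> :: complex^('n \<times> 'n). \<psi> \<in> V_alpha \<alpha> \<Longrightarrow>
      Re (quad_form P_omega \<psi>) \<le> mu_alpha \<alpha> (P_omega :: complex^('n \<times> 'n)^('n \<times> 'n))"
proof -
  let ?m = "\<alpha>\<^sup>2 / (real CARD('n) * (k + (\<alpha> - k)\<^sup>2))"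
  have le: "Re (quad_form P_omega \<psi>) \<le> ?m" if "\<psi> \<in> V_alpha \<alpha>" for \<psi> :: "complex^('n \<times> 'n)"
    using divide_right_mono[OF admissible_trace_bound[of \<alpha> \<psi>], of "real CARD('n)"] assms that
    by (simp add: quad_form_P_omega V_alpha_def mult.commute)
  obtain \<psi> :: "complex^('n \<times> 'n)" where "\<psi> \<in> V_alpha \<alpha>"
    "(cmod (trace (coeff_matrix \<psi>)))\<^sup>2 = \<alpha>\<^sup>2 / (k + (\<alpha> - k)\<^sup>2)"
    using V_alpha_optimal[OF assms(1,2)] unfolding k_def by blast
  then have "?m \<in> (\<lambda>\<psi>. Re (quad_form P_omega \<psi>)) ` (V_alpha \<alpha> :: (complex^('n \<times> 'n)) set)"
    by (intro image_eqI[of _ _ \<psi>]) (simp_all add: quad_form_P_omega mult.commute)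
  then show eq: "mu_alpha \<alpha> (P_omega :: complex^('n \<times> 'n)^('n \<times> 'n)) = ?m"
    unfolding mu_alpha_def using le by (intro cSup_eq_maximum) auto
  show "Re (quad_form P_omega \<psi>) \<le> mu_alpha \<alpha> (P_omega :: complex^('n \<times> 'n)^('n \<times> 'n))"
    if "\<psi> \<in> V_alpha \<alpha>" for \<psi> :: "complex^('n \<times> 'n)"
    using le[OF that] eq by simp
qed

subsection \<open>Conjugation by local unitaries\<close>

text \<open>The operator U (x) cnj U. With the conjugate on the second factor a coefficient matrix
  is conjugated by \<open>U\<close>, so scalar matrices, and with them omega, stay fixed.\<close>

definition kron_cnj :: "complex^'n^'n \<Rightarrow> complex^('n::finite \<times> 'n)^('n \<times> 'n)" where
  "kron_cnj U = (\<chi> p q. U $ fst p $ fst q * cnj (U $ snd p $ snd q))"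

lemma unitary_kron_cnj:
  assumes "unitary U"
  shows "unitary (kron_cnj U)"
proof -
  have U: "(\<Sum>k\<in>UNIV. cnj (U $ k $ i) * U $ k $ j) = (if i = j then 1 else 0)" for i j
    using assms by (simp add: unitary_def vec_eq_iff matrix_mult_nth mat_def)
  have "(conj_transpose (kron_cnj U) ** kron_cnj U) $ p $ q = mat 1 $ p $ q" for p q
  proof -
    have "(conj_transpose (kron_cnj U) ** kron_cnj U) $ p $ q =
      (\<Sum>k\<in>UNIV. cnj (U $ k $ fst p) * U $ k $ fst q) *
      cnj (\<Sum>l\<in>UNIV. cnj (U $ l $ snd p) * U $ l $ snd q)"
      by (simp add: matrix_mult_nth kron_cnj_def sum_UNIV_prod sum_product mult_ac)
    then show ?thesis
      by (simp add: U mat_def prod_eq_iff)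
  qed
  then show ?thesis by (simp add: unitary_def vec_eq_iff)
qed

lemma conj_transpose_kron_cnj: "conj_transpose (kron_cnj U) = kron_cnj (conj_transpose U)"
  by (simp add: vec_eq_iff kron_cnj_def)

lemma coeff_matrix_kron_cnj: "coeff_matrix (kron_cnj U *v \<psi>) = U ** coeff_matrix \<psi> ** conj_transpose U"
proof -
  have "coeff_matrix (kron_cnj U *v \<psi>) $ i $ j = (U ** coeff_matrix \<psi> ** conj_transpose U) $ i $ j" for i j
  proof -
    have "coeff_matrix (kron_cnj U *v \<psi>) $ i $ j =
        (\<Sum>k\<in>UNIV. \<Sum>l\<in>UNIV. U $ i $ k * cnj (U $ j $ l) * \<psi> $ (k, l))"
      by (simp add: coeff_matrix_def matrix_vector_mult_def kron_cnj_def sum_UNIV_prod)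
    also have "\<dots> = (\<Sum>l\<in>UNIV. \<Sum>k\<in>UNIV. U $ i $ k * cnj (U $ j $ l) * \<psi> $ (k, l))"
      by (rule sum.swap)
    also have "\<dots> = (U ** coeff_matrix \<psi> ** conj_transpose U) $ i $ j"
      by (simp add: matrix_mult_nth coeff_matrix_def sum_distrib_left sum_distrib_right mult_ac)
    finally show ?thesis .
  qed
  then show ?thesis by (simp add: vec_eq_iff)
qed

lemma conj_outer: "V ** outer \<psi> ** conj_transpose V = outer (V *v \<psi>)"
  unfolding vec_eq_iff
  by (simp add: outer_def matrix_vector_mult_def matrix_mult_nth sum_distrib_left sum_distrib_right mult_ac)

lemma trace_outer: "trace (outer \<psi>) = of_real ((norm \<psi>)\<^sup>2)"
  by (simp add: trace_def outer_def norm_vec_def L2_set_def sum_nonneg complex_norm_square del: of_real_power)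

lemma quad_form_eq_trace: "quad_form X v = trace (X ** outer v)"
  by (simp add: quad_form_def trace_def matrix_mult_nth outer_def matrix_vector_mult_def sum_distrib_left mult_ac)

lemma norm_unitary_mult_vec:
  assumes "unitary V"
  shows "norm (V *v \<psi>) = norm \<psi>"
proof -
  have "trace (V ** outer \<psi> ** conj_transpose V) = trace (conj_transpose V ** (V ** outer \<psi>))"
    by (rule trace_mul_sym)
  then have "trace (outer (V *v \<psi>)) = trace (outer \<psi>)"
    using assms by (simp add: conj_outer matrix_mul_assoc unitary_def)
  then have "(norm (V *v \<psi>))\<^sup>2 = (norm \<psi>)\<^sup>2"
    unfolding trace_outer by (simp only: of_real_eq_iff)
  then show ?thesis by simp
qed

lemma unitary_conj_transpose: "unitary U \<Longrightarrow> unitary (conj_transpose U)"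
  by (simp add: unitary_def unitary_right)

lemma V_alpha_kron_cnj:
  assumes "unitary U" "\<psi> \<in> V_alpha \<alpha>"
  shows "kron_cnj U *v \<psi> \<in> V_alpha \<alpha>"
proof -
  have "schmidt_coeff (kron_cnj U *v \<psi>) = schmidt_coeff \<psi>"
    using singular_values_list_unitary_conj[OF unitary_conj_transpose[OF assms(1)]]
    by (simp add: fun_eq_iff schmidt_coeff_def coeff_matrix_kron_cnj)
  then show ?thesis
    using assms norm_unitary_mult_vec[OF unitary_kron_cnj[OF assms(1)], of \<psi>]
    by (simp add: V_alpha_def alpha_admissible_def)
qed

lemma linear_conj: "linear (\<lambda>X :: complex^'n^'n. V ** X ** W)"
proof (rule linearI)
  show "V ** (X + Y) ** W = V ** X ** W + V ** Y ** W" for X Y :: "complex^'n^'n"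
    by (simp add: vec_eq_iff matrix_mult_nth ring_distribs sum.distrib)
  show "V ** (r *\<^sub>R X) ** W = r *\<^sub>R (V ** X ** W)" for r and X :: "complex^'n^'n"
    by (simp add: vec_eq_iff matrix_mult_nth)
      (simp add: scaleR_conv_of_real sum_distrib_left sum_distrib_right mult_ac)
qed

text \<open>Conjugation is linear and permutes the generators among themselves, so it respects the
  conic hull; continuity carries this to the closure.\<close>

lemma K_alpha_kron_cnj:
  assumes "unitary U" "X \<in> K_alpha \<alpha>"
  shows "kron_cnj U ** X ** conj_transpose (kron_cnj U) \<in> K_alpha \<alpha>"
proof -
  define f where "f X = kron_cnj U ** X ** conj_transpose (kron_cnj U)" for X
  have lin: "linear f" unfolding f_def by (rule linear_conj)
  have "f ` outer ` V_alpha \<alpha> \<subseteq> outer ` V_alpha \<alpha>"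
    using V_alpha_kron_cnj[OF assms(1)] by (auto simp: f_def conj_outer)
  then have "f ` (convex_cone hull (outer ` V_alpha \<alpha>)) \<subseteq> convex_cone hull (outer ` V_alpha \<alpha>)"
    unfolding convex_cone_hull_linear_image[OF lin, symmetric] by (rule hull_mono)
  then have "f ` K_alpha \<alpha> \<subseteq> K_alpha \<alpha>"
    unfolding K_alpha_def using closure_linear_image_subset[OF lin] closure_mono by blast
  then show ?thesis using assms(2) by (auto simp: f_def)
qed

lemma kron_cnj_omega:
  fixes U :: "complex^'n::finite^'n"
  assumes "unitary U"
  shows "kron_cnj U *v omega_vec = omega_vec"
proof -
  have "coeff_matrix omega_vec = (mat (of_real (1 / sqrt (real CARD('n)))) :: complex^'n^'n)"
    by (simp add: vec_eq_iff coeff_matrix_def omega_vec_def mat_def)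
  moreover have "U ** mat c ** conj_transpose U = mat c" for c
  proof -
    have "U ** mat c ** conj_transpose U = mat c ** (U ** conj_transpose U)"
      by (simp add: mat_mult_commute matrix_mul_assoc)
    then show ?thesis by (simp add: unitary_right[OF assms])
  qed
  ultimately have "coeff_matrix (kron_cnj U *v omega_vec) = coeff_matrix omega_vec"
    by (simp add: coeff_matrix_kron_cnj)
  then show ?thesis
    by (simp add: vec_eq_iff coeff_matrix_def)
qed

lemma quad_form_conj:
  fixes V X :: "complex^'n^'n"
  shows "quad_form (V ** X ** conj_transpose V) v = quad_form X (conj_transpose V *v v)"
proof -
  have "trace (V ** X ** conj_transpose V ** outer v) = trace (V ** (X ** conj_transpose V ** outer v))"
    by (simp add: matrix_mul_assoc)
  also have "\<dots> = trace (X ** (conj_transpose V ** outer v ** conj_transpose (conj_transpose V)))"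
    by (subst trace_mul_sym) (simp add: matrix_mul_assoc)
  finally show ?thesis by (simp only: quad_form_eq_trace conj_outer)
qed

lemma norm_unitary_conj:
  fixes X :: "complex^'n^'n"
  assumes "unitary V"
  shows "norm (V ** X ** conj_transpose V) = norm X"
proof -
  have left: "norm (V ** Y) = norm Y" for Y :: "complex^'n^'n"
  proof -
    have "conj_transpose (V ** Y) ** (V ** Y) = conj_transpose Y ** (conj_transpose V ** V) ** Y"
      by (simp add: conj_transpose_mult matrix_mul_assoc)
    also have "\<dots> = conj_transpose Y ** Y"
      using assms by (simp add: unitary_def)
    finally have "complex_of_real ((norm (V ** Y))\<^sup>2) = of_real ((norm Y)\<^sup>2)"
      by (metis trace_conj_transpose_mult)
    then show ?thesis by (simp only: of_real_eq_iff) simp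
  qed
  have conj: "norm (conj_transpose Y) = norm Y" for Y :: "complex^'n^'n"
  proof -
    have "complex_of_real ((norm (conj_transpose Y))\<^sup>2) = of_real ((norm Y)\<^sup>2)"
      by (metis trace_conj_transpose_mult trace_mult_conj_transpose conj_transpose_conj_transpose)
    then show ?thesis by (simp only: of_real_eq_iff) simp
  qed
  have "V ** X ** conj_transpose V = conj_transpose (V ** conj_transpose (V ** X))"
    by (simp add: conj_transpose_mult)
  then show ?thesis by (simp only: conj left)
qed

section \<open>Operators commuting with all U (x) cnj U\<close>

lemma invariant_commute:
  assumes "unitary V" "V ** X ** conj_transpose V = X"
  shows "V ** X = X ** V"
proof -
  have "V ** X ** (conj_transpose V ** V) = X ** V"
    using assms(2) by (simp add: matrix_mul_assoc)
  then show ?thesis using assms(1) by (simp add: unitary_def)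
qed

text \<open>One family for both kinds of test unitaries: diagonal phases when \<open>\<pi>\<close>
  is the identity, permutations when \<open>u\<close> is constantly 1.\<close>

definition monomial_mat :: "('n \<Rightarrow> 'n) \<Rightarrow> ('n \<Rightarrow> complex) \<Rightarrow> complex^'n^'n" where
  "monomial_mat \<pi> u = (\<chi> i j. if i = \<pi> j then u j else 0)"

lemma unitary_monomial_mat:
  assumes "inj \<pi>" "\<And>i. cmod (u i) = 1"
  shows "unitary (monomial_mat \<pi> u)"
proof -
  have "cnj (u i) * u i = 1" for i
    using complex_norm_square[of "u i"] assms(2)[of i] by (simp add: mult.commute)
  then show ?thesis
    using assms(1)
    by (auto simp: unitary_def vec_eq_iff matrix_mult_nth monomial_mat_def mat_def mult_delta_right inj_eq)
qed

lemma commute_monomial_mat: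
  fixes X :: "complex^('n::finite \<times> 'n)^('n \<times> 'n)"
  assumes "inj \<pi>" and comm: "kron_cnj (monomial_mat \<pi> u) ** X = X ** kron_cnj (monomial_mat \<pi> u)"
  shows "u i * cnj (u j) * X $ (i, j) $ (k, l) = X $ (\<pi> i, \<pi> j) $ (\<pi> k, \<pi> l) * (u k * cnj (u l))"
proof -
  let ?V = "kron_cnj (monomial_mat \<pi> u)"
  have V: "?V $ (a, b) $ (c, d) = (if a = \<pi> c then if b = \<pi> d then u c * cnj (u d) else 0 else 0)" for a b c d
    by (simp add: kron_cnj_def monomial_mat_def)
  have "(?V ** X) $ (\<pi> i, \<pi> j) $ (k, l) = (\<Sum>q\<in>UNIV. if q = (i, j) then u i * cnj (u j) * X $ q $ (k, l) else 0)"
    unfolding matrix_mult_nth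
    by (intro sum.cong refl) (auto simp: V inj_eq[OF assms(1)] split: prod.splits if_splits)
  moreover have "(X ** ?V) $ (\<pi> i, \<pi> j) $ (k, l) =
      (\<Sum>q\<in>UNIV. if q = (\<pi> k, \<pi> l) then X $ (\<pi> i, \<pi> j) $ q * (u k * cnj (u l)) else 0)"
    unfolding matrix_mult_nth
    by (intro sum.cong refl) (auto simp: V split: prod.splits if_splits)
  ultimately show ?thesis using comm by simp
qed

text \<open>The commutant of all \<open>U \<otimes> cnj U\<close>: diagonal phases kill most entries, permutations identify
  the remaining ones up to three constants, and one plane rotation relates these constants.\<close>

lemma twirl_invariant:
  fixes X :: "complex^('n::finite \<times> 'n)^('n \<times> 'n)"
  assumes card: "CARD('n) \<ge> 2"
    and comm: "\<And>U. unitary U \<Longrightarrow> kron_cnj U ** X = X ** kron_cnj U"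
  obtains a b where "\<And>p q. X $ p $ q = a * mat 1 $ p $ q + b * P_omega $ p $ q"
proof -
  obtain p0 q0 :: 'n where pq0: "p0 \<noteq> q0"
    using card by (metis card_2_iff' card_le_Suc0_iff_eq finite not_less_eq_eq numeral_2_eq_2 UNIV_I)
  have mono: "u i * cnj (u j) * X $ (i, j) $ (k, l) = X $ (\<pi> i, \<pi> j) $ (\<pi> k, \<pi> l) * (u k * cnj (u l))"
    if "inj \<pi>" "\<And>i. cmod (u i) = 1" for \<pi> u i j k l
    using commute_monomial_mat[OF that(1) comm[OF unitary_monomial_mat[OF that]]] .
  have zero: "X $ (i, j) $ (k, l) = 0" if "(i, j) \<noteq> (k, l)" "\<not> (i = j \<and> k = l)" for i j k l
  proof -
    have ph: "u i * cnj (u j) * X $ (i, j) $ (k, l) = X $ (i, j) $ (k, l) * (u k * cnj (u l))"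
      if "\<And>i. cmod (u i) = 1" for u
      using mono[where \<pi> = id and u = u] that by simp
    \<comment> \<open>A nonzero entry would force \<open>u i * cnj (u j) = u k * cnj (u l)\<close>
      for all phases \<open>u\<close>. Putting the imaginary unit at a single index, in turn
      \<open>i\<close>, \<open>j\<close> and \<open>k\<close>, already contradicts this.\<close>
    define v where "v m = (\<lambda>n. if n = m then \<i> else 1)" for m :: 'n
    have v: "cmod (v m n) = 1" for m n by (simp add: v_def)
    show ?thesis
      using ph[of "v i", OF v] ph[of "v j", OF v] ph[of "v k", OF v] that
      by (auto simp: v_def complex_eq_iff split: if_splits)
  qed
  have perm: "\<exists>\<pi>. inj \<pi> \<and> \<pi> p0 = p \<and> \<pi> q0 = q" if "p \<noteq> q" for p q :: 'n
  proof -
    let ?t = "Transposition.transpose"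
    \<comment> \<open>The first transposition sends \<open>p0\<close> to \<open>p\<close>; the
      second moves the image of \<open>q0\<close> to \<open>q\<close> and leaves \<open>p\<close>
      alone, as \<open>p\<close> is neither of the two points exchanged.\<close>
    have "inj (?t (?t p0 p q0) q \<circ> ?t p0 p)"
      by (intro inj_compose inj_transpose)
    moreover have "?t p0 p q0 \<noteq> p"
      using pq0 by (metis transpose_apply_first transpose_involutory)
    then have "(?t (?t p0 p q0) q \<circ> ?t p0 p) p0 = p" "(?t (?t p0 p q0) q \<circ> ?t p0 p) q0 = q"
      using that by (simp_all add: transpose_apply_other)
    ultimately show ?thesis by blast
  qed
  define a where "a = X $ (p0, q0) $ (p0, q0)"
  define b where "b = X $ (p0, p0) $ (q0, q0)"
  have a: "X $ (p, q) $ (p, q) = a" and b: "X $ (p, p) $ (q, q) = b" if pq: "p \<noteq> q" for p q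
  proof -
    obtain \<pi> where \<pi>: "inj \<pi>" "\<pi> p0 = p" "\<pi> q0 = q" using perm[OF pq] by blast
    show "X $ (p, q) $ (p, q) = a" "X $ (p, p) $ (q, q) = b"
      using mono[OF \<pi>(1), where u = "\<lambda>_. 1" and i = p0 and j = q0 and k = p0 and l = q0]
        mono[OF \<pi>(1), where u = "\<lambda>_. 1" and i = p0 and j = p0 and k = q0 and l = q0]
      by (simp_all add: a_def b_def \<pi>)
  qed
  have c: "X $ (p, p) $ (p, p) = a + b" for p
  proof -
    obtain q where pq: "p \<noteq> q" using pq0 by metis
    \<comment> \<open>The triple 3, 4, 5 gives a rotation with rational entries, both nonzero.
      Comparing the entry at \<open>(p, p)\<close>, \<open>(p, q)\<close> of the two products leaves
      one relation among the three constants.\<close>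
    define R where "R = rotation p q (3/5) (4/5)"
    have "unitary R" unfolding R_def by (rule unitary_rotation[OF pq]) (simp add: power2_eq_square)
    then have "(kron_cnj R ** X) $ (p, p) $ (p, q) = (X ** kron_cnj R) $ (p, p) $ (p, q)"
      using comm by simp
    moreover have "(kron_cnj R ** X) $ (p, p) $ (p, q) = (\<Sum>r\<in>{(p, q)}. kron_cnj R $ (p, p) $ r * X $ r $ (p, q))"
      unfolding matrix_mult_nth using pq zero by (intro sum.mono_neutral_right) auto
    moreover have "(X ** kron_cnj R) $ (p, p) $ (p, q) =
        (\<Sum>r\<in>{(p, p), (q, q)}. X $ (p, p) $ r * kron_cnj R $ r $ (p, q))"
      unfolding matrix_mult_nth
    proof (intro sum.mono_neutral_right ballI)
      fix r :: "'n \<times> 'n" assume r: "r \<in> UNIV - {(p, p), (q, q)}"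
      show "X $ (p, p) $ r * kron_cnj R $ r $ (p, q) = 0"
      proof (cases "fst r = snd r")
        case True
        then show ?thesis using r pq by (cases r) (auto simp: kron_cnj_def R_def rotation_def)
      next
        case False
        then have "X $ (p, p) $ (fst r, snd r) = 0" by (intro zero) auto
        then show ?thesis by simp
      qed
    qed auto
    ultimately have "kron_cnj R $ (p, p) $ (p, q) * X $ (p, q) $ (p, q) =
        X $ (p, p) $ (p, p) * kron_cnj R $ (p, p) $ (p, q) + X $ (p, p) $ (q, q) * kron_cnj R $ (q, q) $ (p, q)"
      using pq by simp
    moreover have "kron_cnj R $ (p, p) $ (p, q) = - 12 / 25" "kron_cnj R $ (q, q) $ (p, q) = 12 / 25"
      using pq by (simp_all add: kron_cnj_def R_def rotation_def)
    ultimately have "12 * X $ (p, p) $ (p, p) = 12 * (a + b)"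
      using a[OF pq] b[OF pq] by (simp add: field_simps)
    then show ?thesis unfolding mult_cancel_left by simp
  qed
  have P: "P_omega $ (i, j) $ (k, l) = (if i = j \<and> k = l then 1 / of_nat CARD('n) else 0 :: complex)" for i j k l :: 'n
  proof -
    have "(1 / sqrt (real CARD('n))) * (1 / sqrt (real CARD('n))) = 1 / real CARD('n)"
      by simp
    then have "complex_of_real (1 / sqrt (real CARD('n))) * of_real (1 / sqrt (real CARD('n))) = of_real (1 / real CARD('n))"
      by (simp only: flip: of_real_mult)
    then show ?thesis by (auto simp: P_omega_def outer_def omega_vec_def)
  qed
  \<comment> \<open>The nonzero entries of \<open>P_omega\<close> are all 1/d, whence the factor d
    on \<open>b\<close>. At \<open>(p, p)\<close>, \<open>(p, p)\<close> both terms contribute, in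
    agreement with \<open>a + b\<close>.\<close>
  have "X $ p $ q = a * mat 1 $ p $ q + (b * of_nat CARD('n)) * P_omega $ p $ q" for p q
  proof -
    obtain i j k l where pq: "p = (i, j)" "q = (k, l)" by fastforce
    show ?thesis
    proof (cases "(i, j) \<noteq> (k, l) \<and> \<not> (i = j \<and> k = l)")
      case True
      then show ?thesis using zero by (auto simp: pq P mat_def)
    next
      case False
      then show ?thesis using a b c by (auto simp: pq P mat_def)
    qed
  qed
  then show ?thesis using that by blast
qed

subsection \<open>Isotropic states in the cone\<close>

lemma linear_trace: "linear (trace :: complex^'n^'n \<Rightarrow> complex)"
  by (rule linearI) (simp_all add: trace_def sum.distrib scaleR_sum_right)

lemma linear_quad_form: "linear (\<lambda>X. quad_form X v)"
proof -
  have "linear (\<lambda>X :: complex^'a^'a. trace (mat 1 ** X ** outer v))"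
    using linear_compose[OF linear_conj linear_trace] unfolding comp_def .
  then show ?thesis by (simp add: quad_form_eq_trace)
qed

lemma quad_form_lincomb:
  assumes "\<And>p q. X $ p $ q = a * Y $ p $ q + b * Z $ p $ q"
  shows "quad_form X v = a * quad_form Y v + b * quad_form Z v"
  by (simp add: quad_form_def matrix_vector_mult_def assms distrib_right distrib_left sum.distrib
      sum_distrib_left mult_ac)

lemma norm_omega_vec: "norm (omega_vec :: complex^('n::finite \<times> 'n)) = 1"
proof -
  have *: "omega_vec = (monomial_vec id (\<lambda>_. 1 / sqrt (real CARD('n))) :: complex^('n \<times> 'n))"
    by (simp add: omega_vec_def monomial_vec_def vec_eq_iff eq_commute)
  have "(norm (omega_vec :: complex^('n \<times> 'n)))\<^sup>2 = 1"
    unfolding * norm_monomial_vec by (simp add: power_divide)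
  then show ?thesis using norm_ge_zero[of "omega_vec :: complex^('n \<times> 'n)"] by (simp add: power2_eq_1_iff)
qed

lemma trace_P_omega: "trace P_omega = 1"
  by (simp add: P_omega_def trace_outer norm_omega_vec)

lemma quad_form_mat_1: "quad_form (mat 1) v = of_real ((norm v)\<^sup>2)"
  by (simp add: quad_form_eq_trace trace_outer)

lemma quad_form_P_omega_omega:
  "quad_form P_omega (omega_vec :: complex^('n::finite \<times> 'n)) = 1"
proof -
  have "(\<Sum>q\<in>UNIV. cnj ((omega_vec :: complex^('n \<times> 'n)) $ q) * omega_vec $ q) =
      trace (outer (omega_vec :: complex^('n \<times> 'n)))"
    by (simp add: trace_def outer_def mult.commute)
  then show ?thesis
    by (simp add: P_omega_def quad_form_outer trace_outer norm_omega_vec)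
qed

lemma trace_mat_1: "trace (mat 1 :: complex^('n::finite \<times> 'n)^('n \<times> 'n)) = of_real ((real CARD('n))\<^sup>2)"
  by (simp add: trace_def mat_def power2_eq_square)

lemma trace_rho_F:
  assumes "CARD('n::finite) \<ge> 2"
  shows "trace (rho_F F :: complex^('n \<times> 'n)^('n \<times> 'n)) = 1"
proof -
  have "(real CARD('n))\<^sup>2 - 1 > 0" using assms power_mono[of 2 "real CARD('n)" 2] by simp
  then have "((1 - F) / ((real CARD('n))\<^sup>2 - 1)) * ((real CARD('n))\<^sup>2 - 1) + F = 1"
    by simp
  moreover have "trace (rho_F F :: complex^('n \<times> 'n)^('n \<times> 'n)) =
      of_real (((1 - F) / ((real CARD('n))\<^sup>2 - 1)) * ((real CARD('n))\<^sup>2 - 1) + F)"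
    unfolding rho_F_def
    by (simp only: linear_add[OF linear_trace] linear_diff[OF linear_trace] linear_scale[OF linear_trace]
        trace_P_omega trace_mat_1 scaleR_conv_of_real[where 'a = complex] of_real_add of_real_mult
        of_real_diff of_real_1 mult_1_right)
  ultimately show ?thesis by (simp only: of_real_1)
qed

lemma quad_form_rho_F: "quad_form (rho_F F) omega_vec = of_real F"
  unfolding rho_F_def
  by (simp add: linear_add[OF linear_quad_form] linear_diff[OF linear_quad_form] linear_scale[OF linear_quad_form]
      quad_form_P_omega_omega quad_form_mat_1 norm_omega_vec scaleR_conv_of_real[where 'a = complex])

lemma outer_in_K_alpha: "\<psi> \<in> V_alpha \<alpha> \<Longrightarrow> outer \<psi> \<in> K_alpha \<alpha>"
  unfolding K_alpha_def by (intro subsetD[OF closure_subset] hull_inc imageI)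

text \<open>Elements of the cone are not normalised. With the trace on the right the inequality is
  homogeneous, so it cuts out a closed convex cone, and checking the generators suffices.\<close>

lemma K_alpha_fidelity_bound:
  fixes X :: "complex^('n::finite \<times> 'n)^('n \<times> 'n)"
  assumes "1 \<le> \<alpha>" "\<alpha> \<le> real CARD('n)" "X \<in> K_alpha \<alpha>"
  shows "Re (quad_form X omega_vec) \<le> mu_alpha \<alpha> (P_omega :: complex^('n \<times> 'n)^('n \<times> 'n)) * Re (trace X)"
proof -
  let ?m = "mu_alpha \<alpha> (P_omega :: complex^('n \<times> 'n)^('n \<times> 'n))"
  define H where "H = {X :: complex^('n \<times> 'n)^('n \<times> 'n). Re (quad_form X omega_vec) \<le> ?m * Re (trace X)}"
  have "outer \<psi> \<in> H" if "\<psi> \<in> V_alpha \<alpha>" for \<psi> :: "complex^('n \<times> 'n)"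
  proof -
    have "norm \<psi> = 1" using that by (simp add: V_alpha_def alpha_admissible_def Let_def)
    then show ?thesis
      using mu_alpha_P_omega(2)[OF assms(1,2) that]
      by (simp add: H_def trace_outer quad_form_outer_commute[of \<psi>] P_omega_def)
  qed
  moreover have "convex_cone H"
    unfolding convex_cone_iff H_def
    by (auto simp: linear_0[OF linear_quad_form] linear_0[OF linear_trace]
        linear_add[OF linear_quad_form] linear_scale[OF linear_quad_form]
        linear_add[OF linear_trace] linear_scale[OF linear_trace] distrib_left
        mult_left_mono mult.left_commute)
  ultimately have "convex_cone hull (outer ` V_alpha \<alpha>) \<subseteq> H"
    by (intro hull_minimal) auto
  moreover have "closed H"
    unfolding H_def quad_form_def matrix_vector_mult_def trace_def
    by (intro closed_Collect_le continuous_intros)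
  ultimately have "K_alpha \<alpha> \<subseteq> H"
    unfolding K_alpha_def by (rule closure_minimal)
  then show ?thesis using assms(3) by (auto simp: H_def)
qed

lemma rho_F_in_K_alpha:
  assumes card: "CARD('n::finite) \<ge> 2" and \<alpha>: "1 \<le> \<alpha>" "\<alpha> \<le> real CARD('n)"
    and F: "0 \<le> F" "F \<le> mu_alpha \<alpha> (P_omega :: complex^('n \<times> 'n)^('n \<times> 'n))"
  shows "rho_F F \<in> (K_alpha \<alpha> :: (complex^('n \<times> 'n)^('n \<times> 'n)) set)"
proof -
  let ?m = "mu_alpha \<alpha> (P_omega :: complex^('n \<times> 'n)^('n \<times> 'n))"
  note lin = linear_add[OF linear_quad_form] linear_scale[OF linear_quad_form]
    linear_add[OF linear_trace] linear_scale[OF linear_trace]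
  define C where "C = {X :: complex^('n \<times> 'n)^('n \<times> 'n). X \<in> K_alpha \<alpha> \<and> trace X = 1 \<and> quad_form X omega_vec = of_real F}"
  have convK: "convex (K_alpha \<alpha> :: (complex^('n \<times> 'n)^('n \<times> 'n)) set)"
    unfolding K_alpha_def by (intro convex_closure convex_convex_cone_hull)
  have "convex C"
  proof (rule convexI)
    fix X Y :: "complex^('n \<times> 'n)^('n \<times> 'n)" and u v :: real
    assume *: "X \<in> C" "Y \<in> C" "0 \<le> u" "0 \<le> v" "u + v = 1"
    have "u *\<^sub>R z + v *\<^sub>R z = z" for z :: complex
      using *(5) by (simp flip: scaleR_add_left)
    then show "u *\<^sub>R X + v *\<^sub>R Y \<in> C"
      using * convexD[OF convK] by (simp add: C_def lin)
  qed
  have "closed C"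
  proof -
    have "closed (K_alpha \<alpha> :: (complex^('n \<times> 'n)^('n \<times> 'n)) set)"
      by (simp add: K_alpha_def)
    moreover have "closed {X :: complex^('n \<times> 'n)^('n \<times> 'n). trace X = 1}"
      unfolding trace_def by (intro closed_Collect_eq continuous_intros)
    moreover have "closed {X :: complex^('n \<times> 'n)^('n \<times> 'n). quad_form X omega_vec = of_real F}"
      unfolding quad_form_def matrix_vector_mult_def by (intro closed_Collect_eq continuous_intros)
    ultimately show ?thesis
      unfolding C_def by (auto intro: closed_Collect_conj)
  qed
  have "C \<noteq> {}"
  proof -
    obtain \<psi> :: "complex^('n \<times> 'n)" where \<psi>: "\<psi> \<in> V_alpha \<alpha>"
      "(cmod (trace (coeff_matrix \<psi>)))\<^sup>2 = \<alpha>\<^sup>2 / (real_of_int \<lfloor>\<alpha>\<rfloor> + (\<alpha> - real_of_int \<lfloor>\<alpha>\<rfloor>)\<^sup>2)"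
      using V_alpha_optimal[OF \<alpha>] by blast
    obtain \<phi> :: "complex^('n \<times> 'n)" where \<phi>: "\<phi> \<in> V_alpha \<alpha>" "trace (coeff_matrix \<phi>) = 0"
      using V_alpha_traceless[OF card \<alpha>(1)] by blast
    have norm: "norm \<psi> = 1" "norm \<phi> = 1"
      using \<psi>(1) \<phi>(1) by (simp_all add: V_alpha_def alpha_admissible_def Let_def)
    have "quad_form P_omega \<psi> = of_real ?m"
      by (simp only: quad_form_P_omega \<psi>(2) mu_alpha_P_omega(1)[OF \<alpha>]) (simp add: mult.commute)
    then have q: "quad_form (outer \<psi>) omega_vec = of_real ?m" "quad_form (outer \<phi>) omega_vec = 0"
      using \<phi>(2) quad_form_P_omega[of \<phi>] by (simp_all add: quad_form_outer_commute[of _ omega_vec] P_omega_def)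
    have "real_of_int \<lfloor>\<alpha>\<rfloor> \<ge> 1" using \<alpha>(1) by simp
    then have m: "?m > 0"
      using \<alpha> unfolding mu_alpha_P_omega(1)[OF \<alpha>]
      by (intro divide_pos_pos mult_pos_pos add_pos_nonneg) auto
    \<comment> \<open>Fidelity is linear and equals \<open>?m\<close> and 0 at the two ends, so this
      weight yields exactly \<open>F\<close>.\<close>
    define t where "t = F / ?m"
    have t: "0 \<le> t" "t \<le> 1" "t * ?m = F" using F m by (simp_all add: t_def)
    have "t *\<^sub>R outer \<psi> + (1 - t) *\<^sub>R outer \<phi> \<in> K_alpha \<alpha>"
      using t \<psi>(1) \<phi>(1) by (intro convexD[OF convK] outer_in_K_alpha) auto
    then have "t *\<^sub>R outer \<psi> + (1 - t) *\<^sub>R outer \<phi> \<in> C"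
      using t norm by (simp add: C_def lin trace_outer q scaleR_conv_of_real[where 'a = complex] flip: of_real_mult)
    then show ?thesis by blast
  qed
  define X where "X = closest_point C 0"
  have X: "X \<in> C" unfolding X_def by (rule closest_point_in_set) fact+
  have comm: "kron_cnj U ** X = X ** kron_cnj U" if U: "unitary U" for U
  proof -
    let ?V = "kron_cnj U"
    have V: "unitary ?V" using U by (rule unitary_kron_cnj)
    have "trace (?V ** X ** conj_transpose ?V) = trace (conj_transpose ?V ** (?V ** X))"
      by (rule trace_mul_sym)
    also have "\<dots> = trace X"
      using V by (simp add: matrix_mul_assoc unitary_def)
    \<comment> \<open>Fidelity is preserved because the adjoint of \<open>?V\<close> moves onto
      omega, and this adjoint is again of the form U (x) cnj U.\<close>
    finally have "?V ** X ** conj_transpose ?V \<in> C"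
      using X K_alpha_kron_cnj[OF U, of X \<alpha>]
      by (simp add: C_def quad_form_conj)
        (simp add: conj_transpose_kron_cnj kron_cnj_omega unitary_conj_transpose[OF U])
    moreover have "\<forall>Y\<in>C. dist 0 (?V ** X ** conj_transpose ?V) \<le> dist 0 Y"
      using closest_point_le[OF \<open>closed C\<close>, of _ 0]
      by (simp add: norm_unitary_conj[OF V] flip: X_def)
    ultimately have "?V ** X ** conj_transpose ?V = X"
      unfolding X_def using closest_point_unique[OF \<open>convex C\<close> \<open>closed C\<close>] by blast
    then show ?thesis using invariant_commute[OF V] by blast
  qed
  obtain a b where ab: "\<And>p q. X $ p $ q = a * mat 1 $ p $ q + b * P_omega $ p $ q"
    using twirl_invariant[OF card comm] by blast
  \<comment> \<open>Trace and fidelity give \<open>a * d^2 + b = 1\<close> and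
    \<open>a + b = F\<close>. For d \<ge> 2 this system has a unique solution, namely the
    coefficients of \<open>rho_F F\<close>.\<close>
  have "trace X = a * trace (mat 1 :: complex^('n \<times> 'n)^('n \<times> 'n)) + b * trace (P_omega :: complex^('n \<times> 'n)^('n \<times> 'n))"
    by (simp add: trace_def ab sum.distrib sum_distrib_left)
  then have 1: "a * of_real ((real CARD('n))\<^sup>2) + b = 1"
    using X by (simp add: C_def trace_mat_1 trace_P_omega)
  have "quad_form X omega_vec = a * quad_form (mat 1) (omega_vec :: complex^('n \<times> 'n))
      + b * quad_form P_omega (omega_vec :: complex^('n \<times> 'n))"
    by (rule quad_form_lincomb) (rule ab)
  then have 2: "b = of_real F - a"
    using X by (simp add: C_def quad_form_mat_1 norm_omega_vec quad_form_P_omega_omega algebra_simps)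
  have d: "(real CARD('n))\<^sup>2 - 1 > 0" using card power_mono[of 2 "real CARD('n)" 2] by simp
  then have d': "complex_of_real ((real CARD('n))\<^sup>2 - 1) \<noteq> 0"
    unfolding of_real_eq_0_iff by linarith
  have "a * of_real ((real CARD('n))\<^sup>2 - 1) = of_real (1 - F)"
    using 1 unfolding 2 by (simp add: algebra_simps)
  then have a: "a = of_real ((1 - F) / ((real CARD('n))\<^sup>2 - 1))"
    unfolding of_real_divide by (rule eq_divide_imp[OF d'])
  have "rho_F F $ p $ q = a * (mat 1 $ p $ q - P_omega $ p $ q) + of_real F * P_omega $ p $ q"
    for p q :: "'n \<times> 'n"
    unfolding a rho_F_def
    by (simp only: vector_add_component vector_scaleR_component vector_minus_component
        scaleR_conv_of_real[where 'a = complex])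
  then have "X = rho_F F"
    by (simp add: vec_eq_iff ab 2 algebra_simps)
  then show ?thesis using X by (simp add: C_def)
qed

theorem theorem4p6:
  fixes \<alpha> F :: real
  assumes "CARD('n::finite) \<ge> 2"
    and "1 \<le> \<alpha>" and "\<alpha> \<le> real CARD('n)"
    and "0 \<le> F" and "F \<le> 1"
  shows "(rho_F F \<in> (K_alpha \<alpha> :: (complex^('n \<times> 'n)^('n \<times> 'n)) set)
            \<longleftrightarrow> F \<le> mu_alpha \<alpha> (P_omega :: complex^('n \<times> 'n)^('n \<times> 'n)))
       \<and> mu_alpha \<alpha> (P_omega :: complex^('n \<times> 'n)^('n \<times> 'n))
           = (let k = real_of_int \<lfloor>\<alpha>\<rfloor>; \<theta> = \<alpha> - k in
                (k + \<theta>)^2 / (real CARD('n) * (k + \<theta>^2)))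
       \<and> (\<forall>k::nat. 1 \<le> k \<and> k \<le> CARD('n) \<longrightarrow>
            mu_alpha (real k) (P_omega :: complex^('n \<times> 'n)^('n \<times> 'n)) = real k / real CARD('n))"
proof (intro conjI allI impI)
  show "rho_F F \<in> (K_alpha \<alpha> :: (complex^('n \<times> 'n)^('n \<times> 'n)) set)
      \<longleftrightarrow> F \<le> mu_alpha \<alpha> (P_omega :: complex^('n \<times> 'n)^('n \<times> 'n))"
  proof
    assume "rho_F F \<in> (K_alpha \<alpha> :: (complex^('n \<times> 'n)^('n \<times> 'n)) set)"
    then show "F \<le> mu_alpha \<alpha> (P_omega :: complex^('n \<times> 'n)^('n \<times> 'n))"
      using K_alpha_fidelity_bound[OF assms(2,3)]
      by (fastforce simp: quad_form_rho_F trace_rho_F[OF assms(1)])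
  qed (rule rho_F_in_K_alpha[OF assms(1-4)])
  show "mu_alpha \<alpha> (P_omega :: complex^('n \<times> 'n)^('n \<times> 'n))
      = (let k = real_of_int \<lfloor>\<alpha>\<rfloor>; \<theta> = \<alpha> - k in (k + \<theta>)^2 / (real CARD('n) * (k + \<theta>^2)))"
    by (simp add: mu_alpha_P_omega(1)[OF assms(2,3)] Let_def)
  show "mu_alpha (real k) (P_omega :: complex^('n \<times> 'n)^('n \<times> 'n)) = real k / real CARD('n)"
    if "1 \<le> k \<and> k \<le> CARD('n)" for k :: nat
    using mu_alpha_P_omega(1)[where 'n = 'n and \<alpha> = "real k"] that by (simp add: power2_eq_square)
qed

end
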